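(* Let $\Lambda$ be a row-finite $k$-graph with no sources and let $K$ be a field. Then the Kumjian--Pask algebra $\mathrm{KP}_K(\Lambda)$, with its canonical $\mathbb{Z}^k$-grading, is a graded von Neumann regular ring; that is, for every homogeneous element $a$ there is an element $b$ with $aba=a$.
   Context: A $k$-graph is a countable category $\Lambda=(\Lambda^0,\Lambda,r,s)$ (objects identified with identity morphisms $\Lambda^0$; paths composed right to left, so $\lambda\mu$ is defined when $s(\lambda)=r(\mu)$) with a functor $d:\Lambda\to\mathbb{N}^k$ such that if $d(\lambda)=m+n$ there are unique $\mu,\nu\in\Lambda$ with $d(\mu)=m$, $d(\nu)=n$, $\lambda=\mu\nu$. For $v\in\Lambda^0$, $n\in\mathbb{N}^k$, $v\Lambda^n=r^{-1}(v)\cap d^{-1}(n)$. $\Lambda$ is row-finite if every $v\Lambda^n$ is finite, and has no sources if every $v\Lambda^n$ is nonempty. $\mathrm{KP}_K(\Lambda)$ is the $K$-algebra generated by $\Lambda\cup\Lambda^*$ ($\Lambda^*=\{\lambda^*:\lambda\in\Lambda\}$ formal symbols) subject to: (KP1) the elements of $\Lambda^0$ are mutually orthogonal idempotents and $v=v^*$ for $v\in\Lambda^0$; (KP2) for $\lambda,\mu\in\Lambda$ with $r(\mu)=s(\lambda)$, the product $\lambda\mu$ equals the composite $\lambda\circ\mu$, $\mu^*\lambda^*=(\lambda\circ\mu)^*$, $r(\lambda)\lambda=\lambda=\lambda s(\lambda)$, $s(\lambda)\lambda^*=\lambda^*=\lambda^*r(\lambda)$; (KP3) $\lambda^*\mu=\delta_{\lambda,\mu}s(\lambda)$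 whenever $d(\lambda)=d(\mu)$; (KP4) $v=\sum_{\lambda\in v\Lambda^n}\lambda\lambda^*$ for all $v\in\Lambda^0$, $n\in\mathbb{N}^k\setminus\{0\}$. It is $\mathbb{Z}^k$-graded with $\lambda\mu^*$ (for $s(\lambda)=s(\mu)$) homogeneous of degree $d(\lambda)-d(\mu)$. *)

theory Defs
  imports
    "HOL-Analysis.Finite_Cartesian_Product"
    "HOL-Library.Countable_Set"
    "HOL-Library.Poly_Mapping"
    "HOL-Algebra.QuotRing"
begin

section \<open>Higher-rank graphs\<close>

text \<open>
  Degrees live in \<^typ>\<open>nat^'k\<close>; the rank of the graph is \<open>CARD('k)\<close>. The objects are
  identified with their identity morphisms, so \<open>verts\<close> is a subset of \<open>paths\<close>.
  The composite \<open>pcomp \<Lambda> l m\<close> is meaningful only if \<open>src \<Lambda> l = rg \<Lambda> m\<close>.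
\<close>

record ('p, 'k) kgraph =
  paths :: "'p set"
  verts :: "'p set"
  rg :: "'p \<Rightarrow> 'p"
  src :: "'p \<Rightarrow> 'p"
  pcomp :: "'p \<Rightarrow> 'p \<Rightarrow> 'p"
  deg :: "'p \<Rightarrow> nat^'k"

locale k_graph =
  fixes \<Lambda> :: "('p, 'k::finite) kgraph"
  assumes countable_paths: "countable (paths \<Lambda>)"
    and verts_paths: "verts \<Lambda> \<subseteq> paths \<Lambda>"
    and rg_verts: "l \<in> paths \<Lambda> \<Longrightarrow> rg \<Lambda> l \<in> verts \<Lambda>"
    and src_verts: "l \<in> paths \<Lambda> \<Longrightarrow> src \<Lambda> l \<in> verts \<Lambda>"
    and rg_vert: "v \<in> verts \<Lambda> \<Longrightarrow> rg \<Lambda> v = v"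
    and src_vert: "v \<in> verts \<Lambda> \<Longrightarrow> src \<Lambda> v = v"
    and pcomp_paths:
      "\<lbrakk>l \<in> paths \<Lambda>; m \<in> paths \<Lambda>; src \<Lambda> l = rg \<Lambda> m\<rbrakk> \<Longrightarrow> pcomp \<Lambda> l m \<in> paths \<Lambda>"
    and rg_pcomp:
      "\<lbrakk>l \<in> paths \<Lambda>; m \<in> paths \<Lambda>; src \<Lambda> l = rg \<Lambda> m\<rbrakk> \<Longrightarrow> rg \<Lambda> (pcomp \<Lambda> l m) = rg \<Lambda> l"
    and src_pcomp:
      "\<lbrakk>l \<in> paths \<Lambda>; m \<in> paths \<Lambda>; src \<Lambda> l = rg \<Lambda> m\<rbrakk> \<Longrightarrow> src \<Lambda> (pcomp \<Lambda> l m) = src \<Lambda> m"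
    and pcomp_assoc:
      "\<lbrakk>l \<in> paths \<Lambda>; m \<in> paths \<Lambda>; n \<in> paths \<Lambda>; src \<Lambda> l = rg \<Lambda> m; src \<Lambda> m = rg \<Lambda> n\<rbrakk>
        \<Longrightarrow> pcomp \<Lambda> (pcomp \<Lambda> l m) n = pcomp \<Lambda> l (pcomp \<Lambda> m n)"
    and rg_pcomp_id: "l \<in> paths \<Lambda> \<Longrightarrow> pcomp \<Lambda> (rg \<Lambda> l) l = l"
    and pcomp_src_id: "l \<in> paths \<Lambda> \<Longrightarrow> pcomp \<Lambda> l (src \<Lambda> l) = l"
    and deg_vert: "v \<in> verts \<Lambda> \<Longrightarrow> deg \<Lambda> v = 0"
    and deg_pcomp:
      "\<lbrakk>l \<in> paths \<Lambda>; m \<in> paths \<Lambda>; src \<Lambda> l = rg \<Lambda> m\<rbrakk>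
        \<Longrightarrow> deg \<Lambda> (pcomp \<Lambda> l m) = deg \<Lambda> l + deg \<Lambda> m"
    and factorisation:
      "\<lbrakk>l \<in> paths \<Lambda>; deg \<Lambda> l = p + q\<rbrakk>
        \<Longrightarrow> \<exists>!(\<mu>, \<nu>). \<mu> \<in> paths \<Lambda> \<and> \<nu> \<in> paths \<Lambda> \<and> src \<Lambda> \<mu> = rg \<Lambda> \<nu> \<and>
              deg \<Lambda> \<mu> = p \<and> deg \<Lambda> \<nu> = q \<and> l = pcomp \<Lambda> \<mu> \<nu>"

definition paths_from :: "('p, 'k::finite) kgraph \<Rightarrow> 'p \<Rightarrow> nat^'k \<Rightarrow> 'p set" where
  "paths_from \<Lambda> v n = {l \<in> paths \<Lambda>. rg \<Lambda> l = v \<and> deg \<Lambda> l = n}"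

definition row_finite :: "('p, 'k::finite) kgraph \<Rightarrow> bool" where
  "row_finite \<Lambda> \<longleftrightarrow> (\<forall>v \<in> verts \<Lambda>. \<forall>n. finite (paths_from \<Lambda> v n))"

definition no_sources :: "('p, 'k::finite) kgraph \<Rightarrow> bool" where
  "no_sources \<Lambda> \<longleftrightarrow> (\<forall>v \<in> verts \<Lambda>. \<forall>n. paths_from \<Lambda> v n \<noteq> {})"


section \<open>Free algebras\<close>

text \<open>
  Finitely supported functions on the monoid of words over \<open>'x\<close>, with the convolution
  product of \<^theory>\<open>HOL-Library.Poly_Mapping\<close>, form the free unital algebra on \<open>'x\<close>.
  Words are wrapped in a datatype because lists do not carry the \<^class>\<open>monoid_add\<close>
  structure given by concatenation.
\<close>

datatype 'x fword = FWord (letters: "'x list")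

instantiation fword :: (type) monoid_add
begin

definition zero_fword :: "'a fword" where
  "0 = FWord []"

definition plus_fword :: "'a fword \<Rightarrow> 'a fword \<Rightarrow> 'a fword" where
  "u + w = FWord (letters u @ letters w)"

instance
  by standard (simp_all add: zero_fword_def plus_fword_def)

end

text \<open>The free unital \<open>'a\<close>-algebra on the set of generators \<open>X\<close>.\<close>

definition free_algebra :: "'x set \<Rightarrow> ('x fword \<Rightarrow>\<^sub>0 'a::field) ring" where
  "free_algebra X =
    \<lparr>carrier = {f. \<forall>w \<in> Poly_Mapping.keys f. set (letters w) \<subseteq> X},
     mult = (*), one = 1, zero = 0, add = (+)\<rparr>"

text \<open>
  This ensures that \<^const>\<open>genideal\<close>, an intersection of ideals, is not taken over the
  empty family when it is applied to a free algebra below.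
\<close>

lemma ring_free_algebra: "ring (free_algebra X :: ('x fword \<Rightarrow>\<^sub>0 'a::field) ring)"
proof -
  define C :: "('x fword \<Rightarrow>\<^sub>0 'a) set"
    where "C = {f. \<forall>w \<in> Poly_Mapping.keys f. set (letters w) \<subseteq> X}"
  have free: "free_algebra X = \<lparr>carrier = C, mult = (*), one = 1, zero = 0, add = (+)\<rparr>"
    by (simp only: free_algebra_def C_def)
  have add: "f + g \<in> C" if "f \<in> C" "g \<in> C" for f g
    using that Poly_Mapping.keys_add[of f g] unfolding C_def by blast
  have neg: "- f \<in> C" if "f \<in> C" for f
    using that by (simp add: C_def)
  have mult: "f * g \<in> C" if f: "f \<in> C" and g: "g \<in> C" for f g
    unfolding C_def
  proof (intro CollectI ballI)
    fix w assume "w \<in> Poly_Mapping.keys (f * g)"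
    then obtain u v where "w = u + v" "u \<in> Poly_Mapping.keys f" "v \<in> Poly_Mapping.keys g"
      using Poly_Mapping.keys_mult[of f g] by blast
    then show "set (letters w) \<subseteq> X"
      using f g by (simp add: C_def plus_fword_def)
  qed
  have zero: "0 \<in> C" and one: "1 \<in> C"
    by (simp_all add: C_def zero_fword_def)
  show ?thesis
    unfolding free
  proof (rule ringI)
    show "abelian_group \<lparr>carrier = C, mult = (*), one = 1, zero = 0, add = (+)\<rparr>"
    proof (rule abelian_groupI)
      fix f assume "f \<in> carrier \<lparr>carrier = C, mult = (*), one = 1, zero = 0, add = (+)\<rparr>"
      then show "\<exists>g \<in> carrier \<lparr>carrier = C, mult = (*), one = 1, zero = 0, add = (+)\<rparr>.
          g \<oplus>\<^bsub>\<lparr>carrier = C, mult = (*), one = 1, zero = 0, add = (+)\<rparr>\<^esub> f =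
          \<zero>\<^bsub>\<lparr>carrier = C, mult = (*), one = 1, zero = 0, add = (+)\<rparr>\<^esub>"
        using neg[of f] by (intro bexI[of _ "- f"]) simp_all
    qed (simp_all add: add zero ac_simps)
    show "Group.monoid \<lparr>carrier = C, mult = (*), one = 1, zero = 0, add = (+)\<rparr>"
      by (rule monoidI) (simp_all add: mult one mult.assoc)
  qed (simp_all add: distrib_left distrib_right)
qed

text \<open>
  The free non-unital algebra on \<open>X\<close> is the subspace spanned by the non-empty words.
\<close>

definition augmentation :: "'x set \<Rightarrow> ('x fword \<Rightarrow>\<^sub>0 'a::field) set" where
  "augmentation X = {f \<in> carrier (free_algebra X). 0 \<notin> Poly_Mapping.keys f}"


section \<open>Kumjian--Pask algebras\<close>

datatype 'p kp_gen = Path 'p | Ghost 'p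

definition kp_gens :: "('p, 'k::finite) kgraph \<Rightarrow> 'p kp_gen set" where
  "kp_gens \<Lambda> = Path ` paths \<Lambda> \<union> Ghost ` paths \<Lambda>"

definition pth :: "'p \<Rightarrow> 'p kp_gen fword \<Rightarrow>\<^sub>0 'a::field" where
  "pth l = Poly_Mapping.single (FWord [Path l]) 1"

definition gst :: "'p \<Rightarrow> 'p kp_gen fword \<Rightarrow>\<^sub>0 'a::field" where
  "gst l = Poly_Mapping.single (FWord [Ghost l]) 1"

text \<open>
  Each relation \<open>a = b\<close> is represented by the element \<open>a - b\<close>. The sum in (KP4) is
  a finite one only if \<open>\<Lambda>\<close> is row-finite.
\<close>

definition kp1 :: "('p, 'k::finite) kgraph \<Rightarrow> ('p kp_gen fword \<Rightarrow>\<^sub>0 'a::field) set" where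
  "kp1 \<Lambda> =
    {pth v * pth w - (if v = w then pth v else 0) | v w. v \<in> verts \<Lambda> \<and> w \<in> verts \<Lambda>} \<union>
    {pth v - gst v | v. v \<in> verts \<Lambda>}"

definition kp2 :: "('p, 'k::finite) kgraph \<Rightarrow> ('p kp_gen fword \<Rightarrow>\<^sub>0 'a::field) set" where
  "kp2 \<Lambda> =
    {pth l * pth m - pth (pcomp \<Lambda> l m) | l m.
      l \<in> paths \<Lambda> \<and> m \<in> paths \<Lambda> \<and> rg \<Lambda> m = src \<Lambda> l} \<union>
    {gst m * gst l - gst (pcomp \<Lambda> l m) | l m.
      l \<in> paths \<Lambda> \<and> m \<in> paths \<Lambda> \<and> rg \<Lambda> m = src \<Lambda> l} \<union>
    {pth (rg \<Lambda> l) * pth l - pth l | l. l \<in> paths \<Lambda>} \<union>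
    {pth l * pth (src \<Lambda> l) - pth l | l. l \<in> paths \<Lambda>} \<union>
    {pth (src \<Lambda> l) * gst l - gst l | l. l \<in> paths \<Lambda>} \<union>
    {gst l * pth (rg \<Lambda> l) - gst l | l. l \<in> paths \<Lambda>}"

definition kp3 :: "('p, 'k::finite) kgraph \<Rightarrow> ('p kp_gen fword \<Rightarrow>\<^sub>0 'a::field) set" where
  "kp3 \<Lambda> =
    {gst l * pth m - (if l = m then pth (src \<Lambda> l) else 0) | l m.
      l \<in> paths \<Lambda> \<and> m \<in> paths \<Lambda> \<and> deg \<Lambda> l = deg \<Lambda> m}"

definition kp4 :: "('p, 'k::finite) kgraph \<Rightarrow> ('p kp_gen fword \<Rightarrow>\<^sub>0 'a::field) set" where
  "kp4 \<Lambda> =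
    {pth v - (\<Sum>l \<in> paths_from \<Lambda> v n. pth l * gst l) | v n. v \<in> verts \<Lambda> \<and> n \<noteq> 0}"

definition kp_ideal :: "('p, 'k::finite) kgraph \<Rightarrow> ('p kp_gen fword \<Rightarrow>\<^sub>0 'a::field) set" where
  "kp_ideal \<Lambda> = Idl\<^bsub>free_algebra (kp_gens \<Lambda>)\<^esub> (kp1 \<Lambda> \<union> kp2 \<Lambda> \<union> kp3 \<Lambda> \<union> kp4 \<Lambda>)"

definition kp_class :: "('p, 'k::finite) kgraph \<Rightarrow> ('p kp_gen fword \<Rightarrow>\<^sub>0 'a::field)
    \<Rightarrow> ('p kp_gen fword \<Rightarrow>\<^sub>0 'a) set" where
  "kp_class \<Lambda> f = kp_ideal \<Lambda> +>\<^bsub>free_algebra (kp_gens \<Lambda>)\<^esub> f"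

text \<open>
  The Kumjian--Pask algebra is in general not unital (it is so only if there are finitely many
  vertices). As an algebra presented by generators and relations it is therefore a
  quotient of the free non-unital algebra. All relators lie in the augmentation ideal, so this
  quotient is the image of the augmentation ideal in the quotient of the free unital algebra.
  The field \<open>one\<close> that the record inherits plays no role.
\<close>

definition kumjian_pask ::
    "('p, 'k::finite) kgraph \<Rightarrow> ('p kp_gen fword \<Rightarrow>\<^sub>0 'a::field) set ring" where
  "kumjian_pask \<Lambda> =
    (free_algebra (kp_gens \<Lambda>) Quot kp_ideal \<Lambda>)
      \<lparr>carrier := kp_class \<Lambda> ` augmentation (kp_gens \<Lambda>)\<rparr>"

definition int_deg :: "('p, 'k::finite) kgraph \<Rightarrow> 'p \<Rightarrow> int^'k" where
  "int_deg \<Lambda> l = (\<chi> i. int (deg \<Lambda> l $ i))"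

text \<open>
  The homogeneous component of degree \<open>\<gamma>\<close> is the linear span of the elements \<open>\<lambda>\<mu>\<^sup>*\<close> with
  \<open>s(\<lambda>) = s(\<mu>)\<close> and \<open>d(\<lambda>) - d(\<mu>) = \<gamma>\<close>: in the free algebra, the span of a set of words
  consists of the elements supported on that set.
\<close>

definition kp_component ::
    "('p, 'k::finite) kgraph \<Rightarrow> int^'k \<Rightarrow> ('p kp_gen fword \<Rightarrow>\<^sub>0 'a::field) set set" where
  "kp_component \<Lambda> \<gamma> =
    kp_class \<Lambda> ` {f. Poly_Mapping.keys f \<subseteq> {FWord [Path l, Ghost m] | l m.
      l \<in> paths \<Lambda> \<and> m \<in> paths \<Lambda> \<and> src \<Lambda> l = src \<Lambda> m \<and> int_deg \<Lambda> l - int_deg \<Lambda> m = \<gamma>}}"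


section \<open>Graded von Neumann regular rings\<close>

text \<open>Associative rings without the requirement of a unit.\<close>

locale nonunital_ring = abelian_group R for R (structure) +
  assumes mult_closed: "\<lbrakk>x \<in> carrier R; y \<in> carrier R\<rbrakk> \<Longrightarrow> x \<otimes> y \<in> carrier R"
    and mult_assoc: "\<lbrakk>x \<in> carrier R; y \<in> carrier R; z \<in> carrier R\<rbrakk>
      \<Longrightarrow> (x \<otimes> y) \<otimes> z = x \<otimes> (y \<otimes> z)"
    and left_distr: "\<lbrakk>x \<in> carrier R; y \<in> carrier R; z \<in> carrier R\<rbrakk>
      \<Longrightarrow> (x \<oplus> y) \<otimes> z = x \<otimes> z \<oplus> y \<otimes> z"
    and right_distr: "\<lbrakk>x \<in> carrier R; y \<in> carrier R; z \<in> carrier R\<rbrakk>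
      \<Longrightarrow> z \<otimes> (x \<oplus> y) = z \<otimes> x \<oplus> z \<otimes> y"

locale graded_ring = nonunital_ring R for R (structure) +
  fixes H :: "'g::group_add \<Rightarrow> 'a set"
  assumes component_subgroup: "additive_subgroup (H \<gamma>) R"
    and component_mult: "\<lbrakk>a \<in> H \<gamma>; b \<in> H \<delta>\<rbrakk> \<Longrightarrow> a \<otimes> b \<in> H (\<gamma> + \<delta>)"
    and direct_sum: "a \<in> carrier R \<Longrightarrow>
      \<exists>!f. (\<forall>\<gamma>. f \<gamma> \<in> H \<gamma>) \<and> finite {\<gamma>. f \<gamma> \<noteq> \<zero>} \<and> a = (\<Oplus>\<gamma> \<in> {\<gamma>. f \<gamma> \<noteq> \<zero>}. f \<gamma>)"

locale graded_von_neumann_regular = graded_ring R H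
  for R (structure) and H :: "'g::group_add \<Rightarrow> 'a set" +
  assumes regular: "a \<in> H \<gamma> \<Longrightarrow> \<exists>b \<in> carrier R. a \<otimes> b \<otimes> a = a"

end

theory Submission
  imports Defs
begin

text \<open>
  All relators are homogeneous for the degree on words with \<open>\<lambda> \<mapsto> d(\<lambda>)\<close>, \<open>\<lambda>\<^sup>* \<mapsto> - d(\<lambda>)\<close>, so the
  ideal they generate is homogeneous and the grading of the free algebra descends to the quotient.
  The elements \<open>\<lambda>\<mu>\<^sup>*\<close> with \<open>s(\<lambda>) = s(\<mu>)\<close> span: by (KP4) \<open>\<lambda>\<mu>\<^sup>*\<close> is a combination of elements
  \<open>(\<lambda>\<sigma>)(\<mu>\<sigma>)\<^sup>*\<close> with \<open>\<sigma>\<close> of any prescribed degree, and if \<open>d(\<mu>) = d(\<alpha>)\<close> then \<open>(\<lambda>\<mu>\<^sup>*)(\<alpha>\<beta>\<^sup>*)\<close> is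
  \<open>\<lambda>\<beta>\<^sup>*\<close> or \<open>0\<close> by (KP3).

  By the same expansion a homogeneous element is a combination of elements \<open>\<lambda>\<mu>\<^sup>*\<close> with
  \<open>d(\<lambda>) = p\<close> and \<open>d(\<mu>) = q\<close> fixed, which multiply like rectangular matrix units. Gaussian
  elimination, combined with McCoy's lemma (if \<open>g - g x g\<close> is von Neumann regular, so is \<open>g\<close>),
  shows that every such combination is regular. Linear independence is not needed.
\<close>

section \<open>Gradings of free algebras\<close>

lemma poly_mapping_eq_sum_single:
  "f = (\<Sum>w \<in> Poly_Mapping.keys f. Poly_Mapping.single w (Poly_Mapping.lookup f w))"
proof (rule poly_mapping_eqI)
  fix k
  show "Poly_Mapping.lookup f k = Poly_Mapping.lookup
      (\<Sum>w \<in> Poly_Mapping.keys f. Poly_Mapping.single w (Poly_Mapping.lookup f w)) k"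
    by (simp add: lookup_sum lookup_single when_def not_in_keys_iff_lookup_eq_zero)
qed

lemma keys_sum_subset:
  assumes "\<And>i. i \<in> A \<Longrightarrow> Poly_Mapping.keys (f i) \<subseteq> S"
  shows "Poly_Mapping.keys (\<Sum>i\<in>A. f i) \<subseteq> S"
  using assms
proof (induction A rule: infinite_finite_induct)
  case (insert x F)
  then show ?case using Poly_Mapping.keys_add[of "f x" "sum f F"] by fastforce
qed simp_all

section \<open>Degrees of words and homogeneous parts\<close>

definition wdeg :: "('x \<Rightarrow> 'g::ab_group_add) \<Rightarrow> 'x fword \<Rightarrow> 'g" where
  "wdeg d w = sum_list (map d (letters w))"

lemma wdeg_add [simp]: "wdeg d (u + w) = wdeg d u + wdeg d w"
  by (simp add: wdeg_def plus_fword_def)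

definition hpart :: "('x \<Rightarrow> 'g::ab_group_add) \<Rightarrow> 'g \<Rightarrow> ('x fword \<Rightarrow>\<^sub>0 'a::field) \<Rightarrow> 'x fword \<Rightarrow>\<^sub>0 'a"
  where "hpart d \<gamma> f = Poly_Mapping.mapp (\<lambda>w c. if wdeg d w = \<gamma> then c else 0) f"

lemma lookup_hpart:
  "Poly_Mapping.lookup (hpart d \<gamma> f) w = (if wdeg d w = \<gamma> then Poly_Mapping.lookup f w else 0)"
  by (simp add: hpart_def lookup_mapp when_def not_in_keys_iff_lookup_eq_zero)

lemma keys_hpart: "Poly_Mapping.keys (hpart d \<gamma> f) = {w \<in> Poly_Mapping.keys f. wdeg d w = \<gamma>}"
  by (auto simp: in_keys_iff lookup_hpart split: if_splits)

lemma hpart_zero [simp]: "hpart d \<gamma> 0 = 0"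
  by (rule poly_mapping_eqI) (simp add: lookup_hpart)

lemma hpart_add: "hpart d \<gamma> (f + g) = hpart d \<gamma> f + hpart d \<gamma> g"
  by (rule poly_mapping_eqI) (simp add: lookup_hpart lookup_add)

lemma hpart_uminus: "hpart d \<gamma> (- f) = - hpart d \<gamma> f"
  by (rule poly_mapping_eqI) (simp add: lookup_hpart)

lemma hpart_diff: "hpart d \<gamma> (f - g) = hpart d \<gamma> f - hpart d \<gamma> g"
  by (rule poly_mapping_eqI) (simp add: lookup_hpart lookup_minus)

lemma hpart_sum: "hpart d \<gamma> (\<Sum>i\<in>A. f i) = (\<Sum>i\<in>A. hpart d \<gamma> (f i))"
  by (induction A rule: infinite_finite_induct) (simp_all add: hpart_add)

definition homogeneous ::
    "('x \<Rightarrow> 'g::ab_group_add) \<Rightarrow> 'g \<Rightarrow> ('x fword \<Rightarrow>\<^sub>0 'a::field) \<Rightarrow> bool" where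
  "homogeneous d \<delta> f \<longleftrightarrow> Poly_Mapping.keys f \<subseteq> {w. wdeg d w = \<delta>}"

lemma homogeneous_zero: "homogeneous d \<delta> 0"
  by (simp add: homogeneous_def)

lemma homogeneous_diff:
  "homogeneous d \<delta> f \<Longrightarrow> homogeneous d \<delta> g \<Longrightarrow> homogeneous d \<delta> (f - g)"
  by (auto simp: homogeneous_def in_keys_iff lookup_minus subset_eq)

lemma homogeneous_sum:
  "(\<And>i. i \<in> A \<Longrightarrow> homogeneous d \<delta> (f i)) \<Longrightarrow> homogeneous d \<delta> (\<Sum>i\<in>A. f i)"
  unfolding homogeneous_def by (rule keys_sum_subset)

lemma homogeneous_mult:
  "homogeneous d \<delta> f \<Longrightarrow> homogeneous d \<epsilon> g \<Longrightarrow> homogeneous d (\<delta> + \<epsilon>) (f * g)"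
  using keys_mult[of f g] by (fastforce simp: homogeneous_def)

lemma hpart_homogeneous:
  assumes "homogeneous d \<delta> f"
  shows "hpart d \<gamma> f = (if \<gamma> = \<delta> then f else 0)"
  by (rule poly_mapping_eqI)
    (use assms in \<open>auto simp: homogeneous_def lookup_hpart in_keys_iff\<close>)

lemma hpart_single:
  "hpart d \<gamma> (Poly_Mapping.single w c) = (if wdeg d w = \<gamma> then Poly_Mapping.single w c else 0)"
  by (rule poly_mapping_eqI) (auto simp: lookup_hpart lookup_single when_def)

text \<open>Prefixing a word shifts every degree by the degree of that word. On monomials this is
  \<open>wdeg_add\<close>; the general case follows by linearity.\<close>

lemma hpart_single_mult:
  "hpart d \<gamma> (Poly_Mapping.single u a * g) = Poly_Mapping.single u a * hpart d (\<gamma> - wdeg d u) g"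
proof -
  have "hpart d \<gamma> (Poly_Mapping.single u a * Poly_Mapping.single w b)
      = Poly_Mapping.single u a * hpart d (\<gamma> - wdeg d u) (Poly_Mapping.single w b)" for w b
    by (auto simp: mult_single hpart_single algebra_simps)
  then show ?thesis
    by (subst (1 2) poly_mapping_eq_sum_single[of g]) (simp only: sum_distrib_left hpart_sum)
qed

lemma hpart_mult_single:
  "hpart d \<gamma> (f * Poly_Mapping.single u a) = hpart d (\<gamma> - wdeg d u) f * Poly_Mapping.single u a"
proof -
  have "hpart d \<gamma> (Poly_Mapping.single w b * Poly_Mapping.single u a)
      = hpart d (\<gamma> - wdeg d u) (Poly_Mapping.single w b) * Poly_Mapping.single u a" for w b
    by (auto simp: mult_single hpart_single algebra_simps)
  then show ?thesis
    by (subst (1 2) poly_mapping_eq_sum_single[of f]) (simp only: sum_distrib_right hpart_sum)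
qed

text \<open>Only the left factor is split into monomials, so that every summand keeps a homogeneous
  part of \<open>g\<close> as a factor. This is the form needed for closure under multiplication in
  \<open>hpart_genideal\<close>.\<close>

lemma hpart_mult_left:
  "hpart d \<gamma> (f * g) = (\<Sum>u \<in> Poly_Mapping.keys f.
     Poly_Mapping.single u (Poly_Mapping.lookup f u) * hpart d (\<gamma> - wdeg d u) g)"
  by (subst (1) poly_mapping_eq_sum_single[of f])
    (simp only: sum_distrib_right hpart_sum hpart_single_mult)

lemma hpart_mult_right:
  "hpart d \<gamma> (f * g) = (\<Sum>u \<in> Poly_Mapping.keys g.
     hpart d (\<gamma> - wdeg d u) f * Poly_Mapping.single u (Poly_Mapping.lookup g u))"
  by (subst (1) poly_mapping_eq_sum_single[of g])
    (simp only: sum_distrib_left hpart_sum hpart_mult_single)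

lemma sum_hpart:
  "(\<Sum>\<gamma> \<in> wdeg d ` Poly_Mapping.keys f. hpart d \<gamma> f) = f"
  by (rule poly_mapping_eqI)
    (simp add: lookup_sum lookup_hpart not_in_keys_iff_lookup_eq_zero[symmetric] image_iff, blast)

section \<open>Congruence modulo an ideal of a free algebra\<close>

lemma free_algebra_simps [simp]:
  "mult (free_algebra X) = (*)" "add (free_algebra X) = (+)"
  "one (free_algebra X) = 1" "zero (free_algebra X) = 0"
  by (simp_all add: free_algebra_def)

abbreviation fcarrier :: "'x set \<Rightarrow> ('x fword \<Rightarrow>\<^sub>0 'a::field) set" where
  "fcarrier X \<equiv> carrier (free_algebra X)"

lemma fcarrier_iff:
  "f \<in> fcarrier X \<longleftrightarrow> (\<forall>w \<in> Poly_Mapping.keys f. set (letters w) \<subseteq> X)"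
  by (simp add: free_algebra_def)

lemma fcarrier_zero [simp, intro]: "0 \<in> fcarrier X"
  by (simp add: fcarrier_iff)

lemma fcarrier_add [intro]: "f \<in> fcarrier X \<Longrightarrow> g \<in> fcarrier X \<Longrightarrow> f + g \<in> fcarrier X"
  using ring.ring_simprules(1)[OF ring_free_algebra[of X], of f g] by simp

lemma fcarrier_mult [intro]: "f \<in> fcarrier X \<Longrightarrow> g \<in> fcarrier X \<Longrightarrow> f * g \<in> fcarrier X"
  using ring.ring_simprules(5)[OF ring_free_algebra[of X], of f g] by simp

lemma fcarrier_uminus [intro]: "f \<in> fcarrier X \<Longrightarrow> - f \<in> fcarrier X"
  by (simp add: fcarrier_iff)

lemma fcarrier_diff [intro]: "f \<in> fcarrier X \<Longrightarrow> g \<in> fcarrier X \<Longrightarrow> f - g \<in> fcarrier X"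
  using fcarrier_add[of f X "- g"] fcarrier_uminus[of g X] by simp

lemma fcarrier_sum [intro]: "(\<And>i. i \<in> A \<Longrightarrow> f i \<in> fcarrier X) \<Longrightarrow> (\<Sum>i\<in>A. f i) \<in> fcarrier X"
  by (induction A rule: infinite_finite_induct) auto

lemma fcarrier_single [intro]: "set (letters w) \<subseteq> X \<Longrightarrow> Poly_Mapping.single w c \<in> fcarrier X"
  by (auto simp: fcarrier_iff split: if_splits)

lemma fcarrier_hpart [intro]: "f \<in> fcarrier X \<Longrightarrow> hpart d \<gamma> f \<in> fcarrier X"
  by (simp add: fcarrier_iff keys_hpart)

lemma a_inv_free_algebra:
  assumes "f \<in> fcarrier X"
  shows "a_inv (free_algebra X) f = - f"
proof -
  interpret F: ring "free_algebra X" by (rule ring_free_algebra)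
  show ?thesis
    by (rule F.minus_equality) (use assms in auto)
qed

lemma ideal_free_algebraI:
  assumes "J \<subseteq> fcarrier X" "0 \<in> J"
    and "\<And>f g. f \<in> J \<Longrightarrow> g \<in> J \<Longrightarrow> f + g \<in> J"
    and "\<And>f. f \<in> J \<Longrightarrow> - f \<in> J"
    and "\<And>f g. f \<in> J \<Longrightarrow> g \<in> fcarrier X \<Longrightarrow> g * f \<in> J"
    and "\<And>f g. f \<in> J \<Longrightarrow> g \<in> fcarrier X \<Longrightarrow> f * g \<in> J"
  shows "ideal J (free_algebra X)"
proof (rule idealI)
  interpret F: ring "free_algebra X" by (rule ring_free_algebra)
  show "subgroup J (add_monoid (free_algebra X))"
  proof (rule F.add.subgroupI)
    fix a assume "a \<in> J"
    then show "\<ominus>\<^bsub>free_algebra X\<^esub> a \<in> J"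
      using assms(1,4) a_inv_free_algebra[of a X] by auto
  qed (use assms in auto)
qed (use assms ring_free_algebra in auto)

locale free_algebra_ideal =
  fixes X :: "'x set" and I :: "('x fword \<Rightarrow>\<^sub>0 'a::field) set"
  assumes ideal: "ideal I (free_algebra X)"
begin

lemma ideal_carrier: "f \<in> I \<Longrightarrow> f \<in> fcarrier X"
  using ideal by (meson additive_subgroup.a_Hcarr ideal.axioms(1))

lemma ideal_zero [simp]: "0 \<in> I"
  using additive_subgroup.zero_closed[OF ideal.axioms(1)[OF ideal]] by simp

lemma ideal_add: "f \<in> I \<Longrightarrow> g \<in> I \<Longrightarrow> f + g \<in> I"
  using additive_subgroup.a_closed[OF ideal.axioms(1)[OF ideal], of f g] by simp

lemma ideal_mult_left: "f \<in> I \<Longrightarrow> g \<in> fcarrier X \<Longrightarrow> g * f \<in> I"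
  using ideal.I_l_closed[OF ideal, of f g] by simp

lemma ideal_mult_right: "f \<in> I \<Longrightarrow> g \<in> fcarrier X \<Longrightarrow> f * g \<in> I"
  using ideal.I_r_closed[OF ideal, of f g] by simp

lemma ideal_uminus: "f \<in> I \<Longrightarrow> - f \<in> I"
  using additive_subgroup.a_inv_closed[OF ideal.axioms(1)[OF ideal]]
    ring.is_abelian_group[OF ring_free_algebra] a_inv_free_algebra[OF ideal_carrier, of f]
  by metis

lemma ideal_diff: "f \<in> I \<Longrightarrow> g \<in> I \<Longrightarrow> f - g \<in> I"
  using ideal_add[of f "- g"] ideal_uminus[of g] by simp

lemma ideal_sum: "(\<And>i. i \<in> A \<Longrightarrow> f i \<in> I) \<Longrightarrow> (\<Sum>i\<in>A. f i) \<in> I"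
  by (induction A rule: infinite_finite_induct) (auto intro: ideal_add)

text \<open>Membership in the carrier is built in: the relation is reflexive exactly on the carrier,
  and each congruence supplies the side conditions of \<open>cls_eq_iff\<close>.\<close>

definition eqv :: "('x fword \<Rightarrow>\<^sub>0 'a) \<Rightarrow> ('x fword \<Rightarrow>\<^sub>0 'a) \<Rightarrow> bool"  (infix "\<doteq>" 50) where
  "f \<doteq> g \<longleftrightarrow> f \<in> fcarrier X \<and> g \<in> fcarrier X \<and> f - g \<in> I"

lemma eqvD: "f \<doteq> g \<Longrightarrow> f \<in> fcarrier X" "f \<doteq> g \<Longrightarrow> g \<in> fcarrier X" "f \<doteq> g \<Longrightarrow> f - g \<in> I"
  by (simp_all add: eqv_def)

lemma eqv_refl: "f \<in> fcarrier X \<Longrightarrow> f \<doteq> f"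
  by (simp add: eqv_def)

lemma eqv_sym: "f \<doteq> g \<Longrightarrow> g \<doteq> f"
  using ideal_uminus[of "f - g"] by (simp add: eqv_def)

lemma eqv_trans [trans]: "f \<doteq> g \<Longrightarrow> g \<doteq> h \<Longrightarrow> f \<doteq> h"
  using ideal_add[of "f - g" "g - h"] by (simp add: eqv_def)

lemma eqv_add: "f \<doteq> f' \<Longrightarrow> g \<doteq> g' \<Longrightarrow> f + g \<doteq> f' + g'"
  using ideal_add[of "f - f'" "g - g'"] by (auto simp: eqv_def algebra_simps)

lemma eqv_diff: "f \<doteq> f' \<Longrightarrow> g \<doteq> g' \<Longrightarrow> f - g \<doteq> f' - g'"
  using ideal_diff[of "f - f'" "g - g'"] by (auto simp: eqv_def algebra_simps)

lemma eqv_mult: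
  assumes "f \<doteq> f'" "g \<doteq> g'"
  shows "f * g \<doteq> f' * g'"
proof -
  \<comment> \<open>This element equals \<open>f * g - f' * g'\<close>.\<close>
  have "(f - f') * g + f' * (g - g') \<in> I"
    using assms by (intro ideal_add ideal_mult_left ideal_mult_right) (auto simp: eqv_def)
  then show ?thesis
    using assms by (auto simp: eqv_def algebra_simps)
qed

lemma eqv_sum: "(\<And>i. i \<in> A \<Longrightarrow> f i \<doteq> g i) \<Longrightarrow> (\<Sum>i\<in>A. f i) \<doteq> (\<Sum>i\<in>A. g i)"
  by (induction A rule: infinite_finite_induct) (auto intro: eqv_add eqv_refl)

definition cls :: "('x fword \<Rightarrow>\<^sub>0 'a) \<Rightarrow> ('x fword \<Rightarrow>\<^sub>0 'a) set" where
  "cls f = I +>\<^bsub>free_algebra X\<^esub> f"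

lemma cls_eq_iff:
  assumes "f \<in> fcarrier X" "g \<in> fcarrier X"
  shows "cls f = cls g \<longleftrightarrow> f \<doteq> g"
proof -
  interpret ideal I "free_algebra X" by (rule ideal)
  have "f \<doteq> g \<longleftrightarrow> f \<in> cls g"
    using assms a_inv_free_algebra[OF assms(2)] by (simp add: eqv_def cls_def a_rcos_module)
  also have "\<dots> \<longleftrightarrow> cls f = cls g"
    using assms a_repr_independence'[of f g] a_rcos_self[of f] by (auto simp: cls_def)
  finally show ?thesis by simp
qed

section \<open>Spans of words modulo the ideal\<close>

definition spans :: "'x fword set \<Rightarrow> ('x fword \<Rightarrow>\<^sub>0 'a) \<Rightarrow> bool" where
  "spans S f \<longleftrightarrow> (\<exists>g. Poly_Mapping.keys g \<subseteq> S \<and> f \<doteq> g)"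

lemma spansI: "f \<doteq> g \<Longrightarrow> Poly_Mapping.keys g \<subseteq> S \<Longrightarrow> spans S f"
  by (auto simp: spans_def)

lemma spans_eqv: "f \<doteq> g \<Longrightarrow> spans S g \<Longrightarrow> spans S f"
  unfolding spans_def using eqv_trans by blast

lemma spans_sum:
  assumes "\<And>i. i \<in> A \<Longrightarrow> spans S (f i)"
  shows "spans S (\<Sum>i\<in>A. f i)"
proof -
  obtain g where g: "\<And>i. i \<in> A \<Longrightarrow> Poly_Mapping.keys (g i) \<subseteq> S \<and> f i \<doteq> g i"
    using assms unfolding spans_def by metis
  show ?thesis
    by (rule spansI[OF eqv_sum keys_sum_subset]) (use g in blast)+
qed

text \<open>The zero of \<open>fword\<close> is the empty word, so multiplication by
  \<open>Poly_Mapping.single 0 c\<close> is scalar multiplication by \<open>c\<close>.\<close>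

lemma spans_scale:
  assumes "spans S f"
  shows "spans S (Poly_Mapping.single 0 c * f)"
proof -
  obtain g where g: "Poly_Mapping.keys g \<subseteq> S" "f \<doteq> g"
    using assms unfolding spans_def by blast
  have "Poly_Mapping.keys (Poly_Mapping.single 0 c * g) \<subseteq> S"
    using keys_mult[of "Poly_Mapping.single 0 c" g] g(1) by (auto split: if_splits)
  with g(2) show ?thesis
    by (intro spansI[OF eqv_mult[OF eqv_refl]] fcarrier_single) (auto simp: zero_fword_def)
qed

lemma spans_trans:
  assumes "spans S f" and "\<And>w. w \<in> S \<Longrightarrow> spans T (Poly_Mapping.single w 1)"
  shows "spans T f"
proof -
  obtain g where g: "Poly_Mapping.keys g \<subseteq> S" "f \<doteq> g"
    using assms unfolding spans_def by blast
  have "g = (\<Sum>w\<in>Poly_Mapping.keys g.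
      Poly_Mapping.single 0 (Poly_Mapping.lookup g w) * Poly_Mapping.single w 1)"
    by (subst poly_mapping_eq_sum_single) (simp add: mult_single)
  moreover have "spans T \<dots>"
    using g(1) assms(2) by (intro spans_sum spans_scale) blast
  ultimately show ?thesis
    using spans_eqv[OF g(2)] by simp
qed

text \<open>By bilinearity only products of two words have to be treated. Coefficients are collected
  in front as monomials on the empty word.\<close>

lemma spans_mult:
  assumes "spans S f" "spans T g"
    and prod: "\<And>u v. u \<in> S \<Longrightarrow> v \<in> T \<Longrightarrow>
      spans U (Poly_Mapping.single u 1 * Poly_Mapping.single v 1)"
  shows "spans U (f * g)"
proof -
  obtain f' g' where f': "Poly_Mapping.keys f' \<subseteq> S" "f \<doteq> f'"
    and g': "Poly_Mapping.keys g' \<subseteq> T" "g \<doteq> g'"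
    using assms unfolding spans_def by blast
  have "f' * g' = (\<Sum>u\<in>Poly_Mapping.keys f'. \<Sum>v\<in>Poly_Mapping.keys g'.
      Poly_Mapping.single u (Poly_Mapping.lookup f' u)
        * Poly_Mapping.single v (Poly_Mapping.lookup g' v))"
    by (subst (1) poly_mapping_eq_sum_single[of f'], subst (1) poly_mapping_eq_sum_single[of g'])
      (simp only: sum_product)
  also have "\<dots> = (\<Sum>u\<in>Poly_Mapping.keys f'. \<Sum>v\<in>Poly_Mapping.keys g'.
      Poly_Mapping.single 0 (Poly_Mapping.lookup f' u * Poly_Mapping.lookup g' v)
        * (Poly_Mapping.single u 1 * Poly_Mapping.single v 1))"
    by (simp add: mult_single)
  moreover have "spans U \<dots>"
    using f'(1) g'(1) by (intro spans_sum spans_scale prod) auto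
  ultimately show ?thesis
    using spans_eqv[OF eqv_mult[OF f'(2) g'(2)]] by simp
qed

section \<open>The non-unital quotient ring for an arbitrary ideal\<close>

definition nonunital_quotient :: "('x fword \<Rightarrow>\<^sub>0 'a) set ring" where
  "nonunital_quotient = (free_algebra X Quot I)\<lparr>carrier := cls ` augmentation X\<rparr>"

lemma augmentation_iff: "f \<in> augmentation X \<longleftrightarrow> f \<in> fcarrier X \<and> 0 \<notin> Poly_Mapping.keys f"
  by (simp add: augmentation_def)

lemma augmentation_carrier: "f \<in> augmentation X \<Longrightarrow> f \<in> fcarrier X"
  by (simp add: augmentation_iff)

lemma augmentation_zero: "0 \<in> augmentation X"
  by (simp add: augmentation_iff)

lemma augmentation_add: "f \<in> augmentation X \<Longrightarrow> g \<in> augmentation X \<Longrightarrow> f + g \<in> augmentation X"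
  using Poly_Mapping.keys_add[of f g] by (auto simp: augmentation_iff)

lemma augmentation_uminus: "f \<in> augmentation X \<Longrightarrow> - f \<in> augmentation X"
  by (auto simp: augmentation_iff)

lemma augmentation_diff: "f \<in> augmentation X \<Longrightarrow> g \<in> augmentation X \<Longrightarrow> f - g \<in> augmentation X"
  using augmentation_add[of f "- g"] augmentation_uminus[of g] by simp

lemma augmentation_mult:
  assumes "f \<in> augmentation X" "g \<in> augmentation X"
  shows "f * g \<in> augmentation X"
proof -
  \<comment> \<open>A concatenation with nonempty prefix is nonempty, so no constant term can arise
    in the product.\<close>
  have nz: "u + v \<noteq> 0" if "u \<noteq> 0" for u v :: "'x fword"
    using that by (cases u) (simp add: plus_fword_def zero_fword_def)
  have "0 \<notin> Poly_Mapping.keys (f * g)"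
  proof
    assume "0 \<in> Poly_Mapping.keys (f * g)"
    then obtain u v where "0 = u + v" "u \<in> Poly_Mapping.keys f"
      using keys_mult[of f g] by blast
    then show False
      using nz[of u v] assms(1) by (auto simp: augmentation_iff)
  qed
  then show ?thesis
    using assms by (auto simp: augmentation_iff)
qed

lemma augmentation_sum: "(\<And>i. i \<in> A \<Longrightarrow> f i \<in> augmentation X) \<Longrightarrow> (\<Sum>i\<in>A. f i) \<in> augmentation X"
  by (induction A rule: infinite_finite_induct) (auto intro: augmentation_add augmentation_zero)

lemma cls_zero: "cls 0 = I"
proof -
  interpret ideal I "free_algebra X" by (rule ideal)
  show ?thesis
    using a_rcos_const[OF ideal_zero] by (simp add: cls_def)
qed

lemma nonunital_quotient_simps:
  "carrier nonunital_quotient = cls ` augmentation X"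
  "zero nonunital_quotient = cls 0"
  by (simp_all add: nonunital_quotient_def FactRing_def cls_zero)

lemma cls_add:
  assumes "f \<in> fcarrier X" "g \<in> fcarrier X"
  shows "cls f \<oplus>\<^bsub>nonunital_quotient\<^esub> cls g = cls (f + g)"
proof -
  interpret ideal I "free_algebra X" by (rule ideal)
  show ?thesis
    using assms a_rcos_sum[of f g] by (simp add: nonunital_quotient_def FactRing_def cls_def)
qed

lemma cls_mult:
  assumes "f \<in> fcarrier X" "g \<in> fcarrier X"
  shows "cls f \<otimes>\<^bsub>nonunital_quotient\<^esub> cls g = cls (f * g)"
proof -
  interpret ideal I "free_algebra X" by (rule ideal)
  show ?thesis
    using assms rcoset_mult_add[of f g] by (simp add: nonunital_quotient_def FactRing_def cls_def)
qed

lemma nonunital_ring_quotient: "nonunital_ring nonunital_quotient"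
proof -
  note simps = nonunital_quotient_simps cls_add cls_mult augmentation_carrier fcarrier_add
    fcarrier_mult augmentation_add augmentation_mult augmentation_zero
  interpret abelian_group nonunital_quotient
  proof (rule abelian_groupI)
    fix x assume "x \<in> carrier nonunital_quotient"
    then obtain f where f: "f \<in> augmentation X" "x = cls f"
      by (auto simp: simps)
    show "\<exists>y\<in>carrier nonunital_quotient. y \<oplus>\<^bsub>nonunital_quotient\<^esub> x = \<zero>\<^bsub>nonunital_quotient\<^esub>"
      by (rule bexI[of _ "cls (- f)"])
        (use f augmentation_uminus[OF f(1)] in \<open>auto simp: simps\<close>)
  qed (auto simp: simps ac_simps)
  show ?thesis
  proof
  qed (auto simp: simps mult.assoc distrib_left distrib_right)
qed

lemma finsum_cls:
  assumes "\<And>i. i \<in> A \<Longrightarrow> f i \<in> augmentation X"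
  shows "(\<Oplus>\<^bsub>nonunital_quotient\<^esub>i\<in>A. cls (f i)) = cls (\<Sum>i\<in>A. f i)"
proof -
  interpret nonunital_ring nonunital_quotient by (rule nonunital_ring_quotient)
  show ?thesis
    using assms
  \<comment> \<open>For infinite \<open>A\<close> both sums take their default value zero.\<close>
  proof (induction A rule: infinite_finite_induct)
    case (insert x F)
    then have "(\<Oplus>\<^bsub>nonunital_quotient\<^esub>i\<in>insert x F. cls (f i)) =
        cls (f x) \<oplus>\<^bsub>nonunital_quotient\<^esub> (\<Oplus>\<^bsub>nonunital_quotient\<^esub>i\<in>F. cls (f i))"
      by (intro finsum_insert) (auto simp: nonunital_quotient_simps)
    also have "\<dots> = cls (f x) \<oplus>\<^bsub>nonunital_quotient\<^esub> cls (\<Sum>i\<in>F. f i)"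
      using insert by simp
    also have "\<dots> = cls (f x + (\<Sum>i\<in>F. f i))"
      using insert by (intro cls_add) (auto intro: augmentation_carrier)
    finally show ?case using insert by simp
  qed (simp_all add: nonunital_quotient_simps finsum_infinite)
qed

end

text \<open>The elements all of whose homogeneous parts lie in the generated ideal form an ideal
  \<open>J\<close> themselves. It contains the homogeneous generators, hence by minimality the whole
  generated ideal.\<close>

lemma hpart_genideal:
  fixes S :: "('x fword \<Rightarrow>\<^sub>0 'a::field) set" and d :: "'x \<Rightarrow> 'g::ab_group_add"
  assumes S: "S \<subseteq> fcarrier X"
    and hom: "\<And>s. s \<in> S \<Longrightarrow> \<exists>\<delta>. homogeneous d \<delta> s"
    and f: "f \<in> Idl\<^bsub>free_algebra X\<^esub> S"
  shows "hpart d \<gamma> f \<in> Idl\<^bsub>free_algebra X\<^esub> S"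
proof -
  interpret F: ring "free_algebra X :: ('x fword \<Rightarrow>\<^sub>0 'a) ring" by (rule ring_free_algebra)
  define I where "I = Idl\<^bsub>free_algebra X\<^esub> S"
  interpret free_algebra_ideal X I
    by (rule free_algebra_ideal.intro) (unfold I_def, rule F.genideal_ideal[OF S])
  define J where "J = {f \<in> fcarrier X. \<forall>\<gamma>. hpart d \<gamma> f \<in> I}"
  have "ideal J (free_algebra X)"
  proof (rule ideal_free_algebraI)
    fix f g :: "'x fword \<Rightarrow>\<^sub>0 'a" assume f: "f \<in> J" and g: "g \<in> fcarrier X"
    have u: "Poly_Mapping.single u c \<in> fcarrier X" if "u \<in> Poly_Mapping.keys g" for u c
      using g that by (intro fcarrier_single) (simp add: fcarrier_iff)
    show "g * f \<in> J"
      using f g u unfolding J_def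
      by (auto simp: hpart_mult_left intro!: ideal_sum ideal_mult_left)
    show "f * g \<in> J"
      using f g u unfolding J_def
      by (auto simp: hpart_mult_right intro!: ideal_sum ideal_mult_right)
  qed (auto simp: J_def hpart_add hpart_uminus intro: ideal_add ideal_uminus)
  moreover have "S \<subseteq> J"
  proof
    fix s assume s: "s \<in> S"
    obtain \<delta> where \<delta>: "homogeneous d \<delta> s"
      using hom[OF s] by blast
    have "s \<in> I"
      using F.genideal_self[OF S] s by (auto simp: I_def)
    then show "s \<in> J"
      using s S hpart_homogeneous[OF \<delta>] by (auto simp: J_def)
  qed
  ultimately have "I \<subseteq> J"
    unfolding I_def by (rule F.genideal_minimal)
  then show ?thesis
    using f by (auto simp: J_def I_def)
qed

section \<open>Kumjian--Pask relations\<close>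

fun gen_deg :: "('p, 'k::finite) kgraph \<Rightarrow> 'p kp_gen \<Rightarrow> int^'k" where
  "gen_deg \<Lambda> (Path l) = int_deg \<Lambda> l"
| "gen_deg \<Lambda> (Ghost l) = - int_deg \<Lambda> l"

abbreviation kp_relators ::
    "('p, 'k::finite) kgraph \<Rightarrow> ('p kp_gen fword \<Rightarrow>\<^sub>0 'a::field) set" where
  "kp_relators \<Lambda> \<equiv> kp1 \<Lambda> \<union> kp2 \<Lambda> \<union> kp3 \<Lambda> \<union> kp4 \<Lambda>"

lemma pth_carrier: "l \<in> paths \<Lambda> \<Longrightarrow> pth l \<in> fcarrier (kp_gens \<Lambda>)"
  unfolding pth_def by (intro fcarrier_single) (simp add: kp_gens_def)

lemma gst_carrier: "l \<in> paths \<Lambda> \<Longrightarrow> gst l \<in> fcarrier (kp_gens \<Lambda>)"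
  unfolding gst_def by (intro fcarrier_single) (simp add: kp_gens_def)

lemma (in k_graph) vert_path: "v \<in> verts \<Lambda> \<Longrightarrow> v \<in> paths \<Lambda>"
  using verts_paths by blast

lemma (in k_graph) kp_relators_carrier: "kp_relators \<Lambda> \<subseteq> fcarrier (kp_gens \<Lambda>)"
proof -
  note carr = fcarrier_diff fcarrier_mult fcarrier_sum pth_carrier gst_carrier
    vert_path pcomp_paths rg_verts src_verts
  have "kp1 \<Lambda> \<subseteq> fcarrier (kp_gens \<Lambda>)"
    unfolding kp1_def by (auto intro!: carr)
  moreover have "kp2 \<Lambda> \<subseteq> fcarrier (kp_gens \<Lambda>)"
    unfolding kp2_def by (auto intro!: carr(1-5) intro: carr)
  moreover have "kp3 \<Lambda> \<subseteq> fcarrier (kp_gens \<Lambda>)"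
    unfolding kp3_def by (auto intro!: carr)
  moreover have "kp4 \<Lambda> \<subseteq> fcarrier (kp_gens \<Lambda>)"
    unfolding kp4_def paths_from_def by (auto intro!: carr)
  ultimately show ?thesis by simp
qed

lemma (in k_graph) int_deg_vert: "v \<in> verts \<Lambda> \<Longrightarrow> int_deg \<Lambda> v = 0"
  by (simp add: int_deg_def deg_vert vec_eq_iff)

lemma (in k_graph) int_deg_pcomp:
  "\<lbrakk>l \<in> paths \<Lambda>; m \<in> paths \<Lambda>; src \<Lambda> l = rg \<Lambda> m\<rbrakk>
    \<Longrightarrow> int_deg \<Lambda> (pcomp \<Lambda> l m) = int_deg \<Lambda> l + int_deg \<Lambda> m"
  by (simp add: int_deg_def deg_pcomp vec_eq_iff)

lemma homogeneous_pth: "homogeneous (gen_deg \<Lambda>) (int_deg \<Lambda> l) (pth l)"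
  by (simp add: homogeneous_def pth_def wdeg_def)

lemma homogeneous_gst: "homogeneous (gen_deg \<Lambda>) (- int_deg \<Lambda> l) (gst l)"
  by (simp add: homogeneous_def gst_def wdeg_def)

text \<open>The terms of a relator from (KP1), (KP3) or (KP4) all have degree zero; for (KP2) the
  degrees agree because the degree is additive on composites and zero on vertices.\<close>

lemma (in k_graph) kp_relators_homogeneous:
  assumes "s \<in> kp_relators \<Lambda>"
  shows "\<exists>\<delta>. homogeneous (gen_deg \<Lambda>) \<delta> s"
proof -
  note pg = homogeneous_mult[OF homogeneous_pth homogeneous_gst, of \<Lambda>]
  note gp = homogeneous_mult[OF homogeneous_gst homogeneous_pth, of \<Lambda>]
  note p = homogeneous_pth[of \<Lambda>] and g = homogeneous_gst[of \<Lambda>]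
  consider "s \<in> kp1 \<Lambda>" | "s \<in> kp2 \<Lambda>" | "s \<in> kp3 \<Lambda>" | "s \<in> kp4 \<Lambda>"
    using assms by blast
  then show ?thesis
  proof cases
    case 1
    have *: "homogeneous (gen_deg \<Lambda>) 0 (pth v)" "homogeneous (gen_deg \<Lambda>) 0 (gst v)"
      if "v \<in> verts \<Lambda>" for v
      using p[of v] g[of v] int_deg_vert[OF that] by simp_all
    have "homogeneous (gen_deg \<Lambda>) 0 (pth v * pth w)"
      if "v \<in> verts \<Lambda>" "w \<in> verts \<Lambda>" for v w
      using homogeneous_mult[OF *(1) *(1)] that by simp
    with 1 * show ?thesis
      unfolding kp1_def by (auto intro!: exI[of _ 0] homogeneous_diff homogeneous_zero)
  next
    case 2
    \<comment> \<open>In (KP2) the common degree depends on the paths. The degrees of the two terms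
      are found separately, and \<open>\<delta> = \<epsilon>\<close> is left as an identity between
      values of \<open>int_deg\<close>.\<close>
    have a: "\<exists>\<delta>. homogeneous (gen_deg \<Lambda>) \<delta> (f - h)"
      if "homogeneous (gen_deg \<Lambda>) \<delta> f" "homogeneous (gen_deg \<Lambda>) \<epsilon> h" "\<delta> = \<epsilon>" for f h \<delta> \<epsilon>
      using that homogeneous_diff by blast
    show ?thesis
      using 2 unfolding kp2_def
      by (auto simp: int_deg_pcomp int_deg_vert rg_verts src_verts
          intro!: a[OF homogeneous_mult[OF p p] p] a[OF homogeneous_mult[OF g g] g]
             a[OF homogeneous_mult[OF p g] g] a[OF homogeneous_mult[OF g p] g])
  next
    case 3
    have "homogeneous (gen_deg \<Lambda>) 0 (gst l * pth m)" if "deg \<Lambda> l = deg \<Lambda> m" for l m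
      using gp[of l m] that by (simp add: int_deg_def)
    moreover have "homogeneous (gen_deg \<Lambda>) 0 (pth (src \<Lambda> l))" if "l \<in> paths \<Lambda>" for l
      using p[of "src \<Lambda> l"] int_deg_vert[OF src_verts[OF that]] by simp
    ultimately show ?thesis
      using 3 unfolding kp3_def by (auto intro!: exI[of _ 0] homogeneous_diff homogeneous_zero)
  next
    case 4
    have "homogeneous (gen_deg \<Lambda>) 0 (pth l * gst l)" for l
      using pg[of l l] by simp
    moreover have "homogeneous (gen_deg \<Lambda>) 0 (pth v)" if "v \<in> verts \<Lambda>" for v
      using p[of v] int_deg_vert[OF that] by simp
    ultimately show ?thesis
      using 4 unfolding kp4_def by (auto intro!: exI[of _ 0] homogeneous_diff homogeneous_sum)
  qed
qed

text \<open>The ideal stays a parameter so that the results on arbitrary ideals apply to it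
  directly; \<open>I_eq\<close> ties it to the relations.\<close>

locale kp_algebra = k_graph \<Lambda> + free_algebra_ideal "kp_gens \<Lambda>" I
  for \<Lambda> :: "('p, 'k::finite) kgraph" and I :: "('p kp_gen fword \<Rightarrow>\<^sub>0 'a::field) set" +
  assumes I_eq: "I = kp_ideal \<Lambda>"
begin

notation eqv (infix "\<doteq>" 50)

lemma relator_in_ideal: "s \<in> kp_relators \<Lambda> \<Longrightarrow> s \<in> I"
  using ring.genideal_self[OF ring_free_algebra kp_relators_carrier]
  unfolding I_eq kp_ideal_def by blast

lemma hpart_ideal:
  assumes "f \<in> I"
  shows "hpart (gen_deg \<Lambda>) \<gamma> f \<in> I"
  using assms unfolding I_eq kp_ideal_def
  by (intro hpart_genideal kp_relators_carrier kp_relators_homogeneous)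

text \<open>Homogeneous parts are thus well defined on classes, which allows degrees to be compared
  in the quotient.\<close>

lemma eqv_hpart: "f \<doteq> g \<Longrightarrow> hpart (gen_deg \<Lambda>) \<gamma> f \<doteq> hpart (gen_deg \<Lambda>) \<gamma> g"
  using hpart_ideal[of "f - g"] by (auto simp: eqv_def hpart_diff)

section \<open>The defining relations as congruences\<close>

lemmas gen_carrier = pth_carrier gst_carrier

lemma eqv_relator:
  "f - g \<in> kp_relators \<Lambda> \<Longrightarrow> f \<in> fcarrier (kp_gens \<Lambda>) \<Longrightarrow> g \<in> fcarrier (kp_gens \<Lambda>) \<Longrightarrow> f \<doteq> g"
  using relator_in_ideal unfolding eqv_def by blast

lemma vert_eqv: "v \<in> verts \<Lambda> \<Longrightarrow> pth v \<doteq> gst v"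
  by (rule eqv_relator) (auto simp: kp1_def intro: gen_carrier vert_path)

lemma pth_pth_eqv:
  "\<lbrakk>l \<in> paths \<Lambda>; m \<in> paths \<Lambda>; src \<Lambda> l = rg \<Lambda> m\<rbrakk> \<Longrightarrow> pth l * pth m \<doteq> pth (pcomp \<Lambda> l m)"
  by (rule eqv_relator) (drule sym, unfold kp2_def, blast, auto intro: gen_carrier pcomp_paths)

lemma gst_gst_eqv:
  "\<lbrakk>l \<in> paths \<Lambda>; m \<in> paths \<Lambda>; src \<Lambda> l = rg \<Lambda> m\<rbrakk> \<Longrightarrow> gst m * gst l \<doteq> gst (pcomp \<Lambda> l m)"
  by (rule eqv_relator) (drule sym, unfold kp2_def, blast, auto intro: gen_carrier pcomp_paths)

lemma pth_src_eqv: "l \<in> paths \<Lambda> \<Longrightarrow> pth l * pth (src \<Lambda> l) \<doteq> pth l"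
  by (rule eqv_relator) (unfold kp2_def, blast, auto intro: gen_carrier vert_path src_verts)

lemma src_gst_eqv: "l \<in> paths \<Lambda> \<Longrightarrow> pth (src \<Lambda> l) * gst l \<doteq> gst l"
  by (rule eqv_relator) (unfold kp2_def, blast, auto intro: gen_carrier vert_path src_verts)

lemma gst_pth_eqv:
  "\<lbrakk>l \<in> paths \<Lambda>; m \<in> paths \<Lambda>; deg \<Lambda> l = deg \<Lambda> m\<rbrakk>
    \<Longrightarrow> gst l * pth m \<doteq> (if l = m then pth (src \<Lambda> l) else 0)"
  by (rule eqv_relator)
    (blast intro: UnI1 UnI2 intro!: kp3_def[THEN equalityD2, THEN subsetD],
      auto intro: gen_carrier vert_path src_verts)

lemma vert_expand_eqv:
  "\<lbrakk>v \<in> verts \<Lambda>; n \<noteq> 0\<rbrakk> \<Longrightarrow> pth v \<doteq> (\<Sum>l \<in> paths_from \<Lambda> v n. pth l * gst l)"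
  by (rule eqv_relator)
    (unfold kp4_def, blast, auto intro!: gen_carrier fcarrier_sum fcarrier_mult vert_path
      simp: paths_from_def)

text \<open>The common source vertex is inserted between the path and the ghost path and expanded by
  (KP4); the factors \<open>pth e\<close> and \<open>gst e\<close> are then absorbed on either side
  by (KP2).\<close>

lemma expand_eqv:
  assumes l: "l \<in> paths \<Lambda>" and m: "m \<in> paths \<Lambda>" and s: "src \<Lambda> l = src \<Lambda> m" and n: "n \<noteq> 0"
  shows "pth l * gst m \<doteq>
    (\<Sum>e \<in> paths_from \<Lambda> (src \<Lambda> l) n. pth (pcomp \<Lambda> l e) * gst (pcomp \<Lambda> m e))"
proof -
  have "pth l * gst m \<doteq> pth l * (pth (src \<Lambda> l) * gst m)"
    using l m s by (intro eqv_mult eqv_refl eqv_sym[OF src_gst_eqv[OF m, folded s]] gen_carrier)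
  also have "\<dots> \<doteq> pth l * ((\<Sum>e \<in> paths_from \<Lambda> (src \<Lambda> l) n. pth e * gst e) * gst m)"
    using l m n by (intro eqv_mult eqv_refl gen_carrier vert_expand_eqv src_verts)
  also have "\<dots> = (\<Sum>e \<in> paths_from \<Lambda> (src \<Lambda> l) n. (pth l * pth e) * (gst e * gst m))"
    by (simp add: sum_distrib_left sum_distrib_right mult.assoc)
  also have "\<dots> \<doteq>
      (\<Sum>e \<in> paths_from \<Lambda> (src \<Lambda> l) n. pth (pcomp \<Lambda> l e) * gst (pcomp \<Lambda> m e))"
    using l m s by (intro eqv_sum eqv_mult pth_pth_eqv gst_gst_eqv) (auto simp: paths_from_def)
  finally show ?thesis .
qed

text \<open>The multiplication rule of matrix units: (KP3) evaluates the inner product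
  \<open>gst m * pth a\<close> to a vertex or to zero, and the vertex is absorbed by
  \<open>pth l\<close>.\<close>

lemma unit_mult_eqv:
  assumes "l \<in> paths \<Lambda>" "m \<in> paths \<Lambda>" "a \<in> paths \<Lambda>" "b \<in> paths \<Lambda>"
    and "src \<Lambda> l = src \<Lambda> m" "src \<Lambda> a = src \<Lambda> b" "deg \<Lambda> m = deg \<Lambda> a"
  shows "(pth l * gst m) * (pth a * gst b) \<doteq> (if m = a then pth l * gst b else 0)"
proof -
  have "(pth l * gst m) * (pth a * gst b) = pth l * (gst m * pth a) * gst b"
    by (simp add: mult.assoc)
  also have "\<dots> \<doteq> pth l * (if m = a then pth (src \<Lambda> m) else 0) * gst b"
    using assms by (intro eqv_mult eqv_refl gen_carrier gst_pth_eqv)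
  also have "\<dots> \<doteq> (if m = a then pth l * gst b else 0)"
  proof (cases "m = a")
    case True
    then show ?thesis
      using eqv_mult[OF pth_src_eqv[of l] eqv_refl[OF gst_carrier[of b]]] assms by simp
  qed (simp add: eqv_refl)
  finally show ?thesis .
qed

section \<open>Spanning by products of a path and a ghost path\<close>

definition comp_words :: "int^'k \<Rightarrow> 'p kp_gen fword set" where
  "comp_words \<gamma> = {FWord [Path l, Ghost m] | l m.
      l \<in> paths \<Lambda> \<and> m \<in> paths \<Lambda> \<and> src \<Lambda> l = src \<Lambda> m \<and> int_deg \<Lambda> l - int_deg \<Lambda> m = \<gamma>}"

text \<open>For fixed \<open>p\<close> and \<open>q\<close> these are rectangular matrix units, with
  rows indexed by paths of degree \<open>p\<close> and columns by paths of degree \<open>q\<close>;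
  a position exists only where the sources agree.\<close>

definition unit_words :: "nat^'k \<Rightarrow> nat^'k \<Rightarrow> 'p kp_gen fword set" where
  "unit_words p q = {FWord [Path l, Ghost m] | l m.
      l \<in> paths \<Lambda> \<and> m \<in> paths \<Lambda> \<and> src \<Lambda> l = src \<Lambda> m \<and> deg \<Lambda> l = p \<and> deg \<Lambda> m = q}"

lemma single_unit_word: "Poly_Mapping.single (FWord [Path l, Ghost m]) 1 = pth l * gst m"
  by (simp add: pth_def gst_def mult_single plus_fword_def)

lemma spans_unit:
  assumes "FWord [Path l, Ghost m] \<in> S" "l \<in> paths \<Lambda>" "m \<in> paths \<Lambda>"
  shows "spans S (pth l * gst m)"
  using assms by (intro spansI[OF eqv_refl] fcarrier_mult gen_carrier)
    (simp_all add: single_unit_word[symmetric])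

text \<open>Both degrees rise by the same amount, so their difference is kept. This serves to bring
  paths to a common degree, as (KP3) demands.\<close>

lemma spans_expand:
  assumes l: "l \<in> paths \<Lambda>" and m: "m \<in> paths \<Lambda>" and s: "src \<Lambda> l = src \<Lambda> m"
  shows "spans (unit_words (deg \<Lambda> l + n) (deg \<Lambda> m + n)) (pth l * gst m)"
\<comment> \<open>(KP4) is stated for nonzero degrees only; for \<open>n = 0\<close> the product
  already has the required shape.\<close>
proof (cases "n = 0")
  case True
  then show ?thesis
    using assms by (intro spans_unit) (auto simp: unit_words_def)
next
  case False
  have "spans (unit_words (deg \<Lambda> l + n) (deg \<Lambda> m + n))
      (pth (pcomp \<Lambda> l e) * gst (pcomp \<Lambda> m e))" if "e \<in> paths_from \<Lambda> (src \<Lambda> l) n" for e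
    using that assms
    by (intro spans_unit) (auto simp: unit_words_def paths_from_def pcomp_paths deg_pcomp src_pcomp)
  then show ?thesis
    using spans_eqv[OF expand_eqv[OF assms False] spans_sum] by blast
qed

text \<open>The first factor is expanded by \<open>deg \<Lambda> a\<close> and the second by
  \<open>deg \<Lambda> m\<close>. Then both inner paths have degree
  \<open>deg \<Lambda> m + deg \<Lambda> a\<close>, and the product of matrix units applies.\<close>

lemma spans_comp_mult:
  assumes "u \<in> comp_words \<gamma>" "v \<in> comp_words \<delta>"
  shows "spans (comp_words (\<gamma> + \<delta>)) (Poly_Mapping.single u 1 * Poly_Mapping.single v 1)"
proof -
  obtain l m where u: "u = FWord [Path l, Ghost m]" "l \<in> paths \<Lambda>" "m \<in> paths \<Lambda>"
      "src \<Lambda> l = src \<Lambda> m" "int_deg \<Lambda> l - int_deg \<Lambda> m = \<gamma>"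
    using assms(1) by (auto simp: comp_words_def)
  obtain a b where v: "v = FWord [Path a, Ghost b]" "a \<in> paths \<Lambda>" "b \<in> paths \<Lambda>"
      "src \<Lambda> a = src \<Lambda> b" "int_deg \<Lambda> a - int_deg \<Lambda> b = \<delta>"
    using assms(2) by (auto simp: comp_words_def)
  have "spans (comp_words (\<gamma> + \<delta>)) ((pth l * gst m) * (pth a * gst b))"
  proof (rule spans_mult[OF spans_expand[OF u(2-4), of "deg \<Lambda> a"] spans_expand[OF v(2-4), of "deg \<Lambda> m"]])
    fix u' v'
    assume "u' \<in> unit_words (deg \<Lambda> l + deg \<Lambda> a) (deg \<Lambda> m + deg \<Lambda> a)"
      and "v' \<in> unit_words (deg \<Lambda> a + deg \<Lambda> m) (deg \<Lambda> b + deg \<Lambda> m)"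
    then obtain l' m' a' b' where
      u': "u' = FWord [Path l', Ghost m']" "l' \<in> paths \<Lambda>" "m' \<in> paths \<Lambda>" "src \<Lambda> l' = src \<Lambda> m'"
        "deg \<Lambda> l' = deg \<Lambda> l + deg \<Lambda> a" "deg \<Lambda> m' = deg \<Lambda> m + deg \<Lambda> a" and
      v': "v' = FWord [Path a', Ghost b']" "a' \<in> paths \<Lambda>" "b' \<in> paths \<Lambda>" "src \<Lambda> a' = src \<Lambda> b'"
        "deg \<Lambda> a' = deg \<Lambda> a + deg \<Lambda> m" "deg \<Lambda> b' = deg \<Lambda> b + deg \<Lambda> m"
      by (auto simp: unit_words_def)
    have "spans (comp_words (\<gamma> + \<delta>)) (if m' = a' then pth l' * gst b' else 0)"
    proof (cases "m' = a'")
      case True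
      \<comment> \<open>The amounts added to the two inner degrees cancel: the difference is
        \<open>(deg \<Lambda> l + deg \<Lambda> a) - (deg \<Lambda> b + deg \<Lambda> m)\<close>,
        read over the integers.\<close>
      have "int_deg \<Lambda> l' - int_deg \<Lambda> b' = \<gamma> + \<delta>"
        unfolding u(5)[symmetric] v(5)[symmetric] using u'(5) v'(6)
        by (simp add: int_deg_def vec_eq_iff)
      then have "spans (comp_words (\<gamma> + \<delta>)) (pth l' * gst b')"
        using u' v' True by (intro spans_unit) (auto simp: comp_words_def)
      with True show ?thesis by simp
    next
      case False
      then show ?thesis by (auto intro!: spansI[OF eqv_refl])
    qed
    then show "spans (comp_words (\<gamma> + \<delta>)) (Poly_Mapping.single u' 1 * Poly_Mapping.single v' 1)"
      using spans_eqv[OF unit_mult_eqv[OF u'(2,3) v'(2,3) u'(4) v'(4)]] u' v'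
      by (simp add: single_unit_word add.commute)
  qed
  then show ?thesis by (simp add: u v single_unit_word)
qed

text \<open>A path is itself times its source vertex, which (KP1) identifies with a ghost; a ghost
  path is its source vertex times itself. Vertices have degree zero, so the degree is
  unchanged.\<close>

lemma spans_gen:
  assumes "x \<in> kp_gens \<Lambda>"
  shows "spans (comp_words (gen_deg \<Lambda> x)) (Poly_Mapping.single (FWord [x]) 1)"
proof -
  from assms consider l where "x = Path l" "l \<in> paths \<Lambda>" | l where "x = Ghost l" "l \<in> paths \<Lambda>"
    by (auto simp: kp_gens_def)
  then show ?thesis
  proof cases
    case 1
    have v: "src \<Lambda> l \<in> verts \<Lambda>" using 1 src_verts by simp
    have "pth l \<doteq> pth l * gst (src \<Lambda> l)"
      using eqv_trans[OF eqv_sym[OF pth_src_eqv] eqv_mult[OF eqv_refl vert_eqv[OF v]]] 1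
      by (auto intro: gen_carrier)
    moreover have "spans (comp_words (gen_deg \<Lambda> x)) (pth l * gst (src \<Lambda> l))"
      using 1 v by (intro spans_unit) (auto simp: comp_words_def vert_path src_vert int_deg_vert)
    ultimately show ?thesis
      using spans_eqv 1 by (simp add: pth_def)
  next
    case 2
    have v: "src \<Lambda> l \<in> verts \<Lambda>" using 2 src_verts by simp
    have "gst l \<doteq> pth (src \<Lambda> l) * gst l"
      using 2 by (intro eqv_sym[OF src_gst_eqv])
    moreover have "spans (comp_words (gen_deg \<Lambda> x)) (pth (src \<Lambda> l) * gst l)"
      using 2 v by (intro spans_unit) (auto simp: comp_words_def vert_path src_vert int_deg_vert)
    ultimately show ?thesis
      using spans_eqv 2 by (simp add: gst_def)
  qed
qed

lemma spans_word:
  assumes "xs \<noteq> []" "set xs \<subseteq> kp_gens \<Lambda>"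
  shows "spans (comp_words (wdeg (gen_deg \<Lambda>) (FWord xs))) (Poly_Mapping.single (FWord xs) 1)"
  using assms
proof (induction xs rule: list_nonempty_induct)
  case (single x)
  then show ?case using spans_gen[of x] by (simp add: wdeg_def)
next
  case (cons x xs)
  have "Poly_Mapping.single (FWord (x # xs)) (1::'a)
      = Poly_Mapping.single (FWord [x]) 1 * Poly_Mapping.single (FWord xs) 1"
    by (simp add: mult_single plus_fword_def)
  moreover have "wdeg (gen_deg \<Lambda>) (FWord (x # xs))
      = gen_deg \<Lambda> x + wdeg (gen_deg \<Lambda>) (FWord xs)"
    by (simp add: wdeg_def)
  ultimately show ?case
    using cons spans_mult[OF spans_gen[of x] cons.IH spans_comp_mult] by simp
qed

text \<open>Every word in the support is nonempty and has degree \<open>\<gamma>\<close>, so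
  \<open>spans_word\<close> applies to it. This puts the homogeneous parts into the components and
  gives existence of the decomposition.\<close>

lemma spans_hpart:
  assumes "f \<in> augmentation (kp_gens \<Lambda>)"
  shows "spans (comp_words \<gamma>) (hpart (gen_deg \<Lambda>) \<gamma> f)"
proof (rule spans_trans)
  show "spans (Poly_Mapping.keys (hpart (gen_deg \<Lambda>) \<gamma> f)) (hpart (gen_deg \<Lambda>) \<gamma> f)"
    using assms by (intro spansI[OF eqv_refl] fcarrier_hpart augmentation_carrier subset_refl)
  fix w assume "w \<in> Poly_Mapping.keys (hpart (gen_deg \<Lambda>) \<gamma> f)"
  then have w: "w \<in> Poly_Mapping.keys f" "wdeg (gen_deg \<Lambda>) w = \<gamma>"
    by (auto simp: keys_hpart)
  then have "set (letters w) \<subseteq> kp_gens \<Lambda>" "w \<noteq> 0"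
    using assms by (auto simp: augmentation_iff fcarrier_iff)
  with w(2) spans_word[of "letters w"] show "spans (comp_words \<gamma>) (Poly_Mapping.single w 1)"
    by (cases w) (auto simp: zero_fword_def)
qed

section \<open>The grading\<close>

lemma kp_class_eq: "kp_class \<Lambda> = cls"
  by (rule ext) (simp add: kp_class_def cls_def I_eq[symmetric])

lemma kumjian_pask_eq: "kumjian_pask \<Lambda> = nonunital_quotient"
  by (simp add: kumjian_pask_def nonunital_quotient_def kp_class_eq I_eq[symmetric])

lemma kp_component_eq: "kp_component \<Lambda> \<gamma> = cls ` {f. Poly_Mapping.keys f \<subseteq> comp_words \<gamma>}"
  by (simp add: kp_component_def comp_words_def kp_class_eq)

lemma comp_words_augmentation:
  assumes "Poly_Mapping.keys f \<subseteq> comp_words \<gamma>"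
  shows "f \<in> augmentation (kp_gens \<Lambda>)"
  using assms unfolding augmentation_iff fcarrier_iff
  by (fastforce simp: comp_words_def kp_gens_def zero_fword_def)

lemma comp_words_homogeneous:
  "Poly_Mapping.keys f \<subseteq> comp_words \<gamma> \<Longrightarrow> homogeneous (gen_deg \<Lambda>) \<gamma> f"
  by (force simp: homogeneous_def comp_words_def wdeg_def)

lemma spans_comp_words_iff:
  assumes "f \<in> fcarrier (kp_gens \<Lambda>)"
  shows "cls f \<in> kp_component \<Lambda> \<gamma> \<longleftrightarrow> spans (comp_words \<gamma>) f"
proof
  assume "cls f \<in> kp_component \<Lambda> \<gamma>"
  then obtain g where g: "cls f = cls g" "Poly_Mapping.keys g \<subseteq> comp_words \<gamma>"
    by (auto simp: kp_component_eq)
  then show "spans (comp_words \<gamma>) f"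
    using cls_eq_iff[OF assms augmentation_carrier[OF comp_words_augmentation]] spansI by blast
next
  assume "spans (comp_words \<gamma>) f"
  then obtain g where "f \<doteq> g" "Poly_Mapping.keys g \<subseteq> comp_words \<gamma>"
    by (auto simp: spans_def)
  then show "cls f \<in> kp_component \<Lambda> \<gamma>"
    using cls_eq_iff[of f g] eqvD[of f g] by (auto simp: kp_component_eq)
qed

lemma kp_componentE:
  assumes "x \<in> kp_component \<Lambda> \<gamma>"
  obtains f where "x = cls f" "Poly_Mapping.keys f \<subseteq> comp_words \<gamma>"
    "f \<in> augmentation (kp_gens \<Lambda>)" "f \<in> fcarrier (kp_gens \<Lambda>)"
  using assms comp_words_augmentation augmentation_carrier by (auto simp: kp_component_eq)

lemma component_subgroup: "additive_subgroup (kp_component \<Lambda> \<gamma>) nonunital_quotient"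
proof -
  interpret nonunital_ring nonunital_quotient by (rule nonunital_ring_quotient)
  show ?thesis
  proof (rule additive_subgroup.intro, rule add.subgroupI)
    show "kp_component \<Lambda> \<gamma> \<subseteq> carrier nonunital_quotient"
      by (auto simp: nonunital_quotient_simps elim!: kp_componentE)
    have "cls 0 \<in> kp_component \<Lambda> \<gamma>"
      by (auto simp: kp_component_eq)
    then show "kp_component \<Lambda> \<gamma> \<noteq> ({} :: ('p kp_gen fword \<Rightarrow>\<^sub>0 'a) set set)" by blast
  next
    fix a :: "('p kp_gen fword \<Rightarrow>\<^sub>0 'a) set"
    assume "a \<in> kp_component \<Lambda> \<gamma>"
    then obtain f where f: "a = cls f" "Poly_Mapping.keys f \<subseteq> comp_words \<gamma>"
      "f \<in> augmentation (kp_gens \<Lambda>)" "f \<in> fcarrier (kp_gens \<Lambda>)"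
      by (rule kp_componentE)
    have "\<ominus>\<^bsub>nonunital_quotient\<^esub> a = cls (- f)"
    proof (rule minus_equality)
      show "cls (- f) \<oplus>\<^bsub>nonunital_quotient\<^esub> a = \<zero>\<^bsub>nonunital_quotient\<^esub>"
        using f(1,4) by (simp add: cls_add fcarrier_uminus nonunital_quotient_simps)
      show "a \<in> carrier nonunital_quotient" "cls (- f) \<in> carrier nonunital_quotient"
        unfolding nonunital_quotient_simps f(1)
        by (intro imageI f(3) augmentation_uminus)+
    qed
    with f(2) show "\<ominus>\<^bsub>nonunital_quotient\<^esub> a \<in> kp_component \<Lambda> \<gamma>"
      by (auto simp: kp_component_eq)
  next
    fix a b :: "('p kp_gen fword \<Rightarrow>\<^sub>0 'a) set"
    assume "a \<in> kp_component \<Lambda> \<gamma>" "b \<in> kp_component \<Lambda> \<gamma>"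
    then obtain f g where f: "a = cls f" "Poly_Mapping.keys f \<subseteq> comp_words \<gamma>"
        "f \<in> fcarrier (kp_gens \<Lambda>)"
      and g: "b = cls g" "Poly_Mapping.keys g \<subseteq> comp_words \<gamma>" "g \<in> fcarrier (kp_gens \<Lambda>)"
      by (auto elim!: kp_componentE)
    have "Poly_Mapping.keys (f + g) \<subseteq> comp_words \<gamma>"
      using Poly_Mapping.keys_add[of f g] f(2) g(2) by blast
    with f g show "a \<oplus>\<^bsub>nonunital_quotient\<^esub> b \<in> kp_component \<Lambda> \<gamma>"
      by (auto simp: kp_component_eq cls_add)
  qed
qed

lemma component_mult:
  assumes "a \<in> kp_component \<Lambda> \<gamma>" "b \<in> kp_component \<Lambda> \<delta>"
  shows "a \<otimes>\<^bsub>nonunital_quotient\<^esub> b \<in> kp_component \<Lambda> (\<gamma> + \<delta>)"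
proof -
  from assms obtain f g where f: "a = cls f" "Poly_Mapping.keys f \<subseteq> comp_words \<gamma>"
      "f \<in> fcarrier (kp_gens \<Lambda>)"
    and g: "b = cls g" "Poly_Mapping.keys g \<subseteq> comp_words \<delta>" "g \<in> fcarrier (kp_gens \<Lambda>)"
    by (auto elim!: kp_componentE)
  have "spans (comp_words (\<gamma> + \<delta>)) (f * g)"
    by (rule spans_mult[OF spansI spansI spans_comp_mult]) (use f g eqv_refl in auto)
  with f g show ?thesis
    by (simp add: cls_mult spans_comp_words_iff fcarrier_mult)
qed

lemma augmentation_hpart:
  "f \<in> augmentation (kp_gens \<Lambda>) \<Longrightarrow> hpart d \<gamma> f \<in> augmentation (kp_gens \<Lambda>)"
  by (simp add: augmentation_iff fcarrier_hpart keys_hpart)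

text \<open>
  The components of \<open>cls f\<close> can only be the classes of the homogeneous parts of \<open>f\<close>, because
  taking homogeneous parts preserves congruence modulo \<open>I\<close>.
\<close>

lemma direct_sum_unique:
  assumes f: "f \<in> augmentation (kp_gens \<Lambda>)"
    and F: "\<And>\<gamma>. F \<gamma> \<in> kp_component \<Lambda> \<gamma>"
    and fin: "finite {\<gamma>. F \<gamma> \<noteq> cls 0}"
    and sum: "cls f = (\<Oplus>\<^bsub>nonunital_quotient\<^esub>\<gamma>\<in>{\<gamma>. F \<gamma> \<noteq> cls 0}. F \<gamma>)"
  shows "F \<gamma> = cls (hpart (gen_deg \<Lambda>) \<gamma> f)"
proof -
  define T where "T = {\<gamma>. F \<gamma> \<noteq> cls 0}"
  have "\<exists>g. F \<gamma> = cls g \<and> Poly_Mapping.keys g \<subseteq> comp_words \<gamma>" for \<gamma>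
    using F[of \<gamma>] by (auto simp: kp_component_eq)
  then obtain g where g: "\<And>\<gamma>. F \<gamma> = cls (g \<gamma>)" "\<And>\<gamma>. Poly_Mapping.keys (g \<gamma>) \<subseteq> comp_words \<gamma>"
    by metis
  note aug = comp_words_augmentation[OF g(2)]
  have "cls f = cls (\<Sum>\<gamma>\<in>T. g \<gamma>)"
    unfolding sum T_def g(1) by (rule finsum_cls) (rule aug)
  then have "f \<doteq> (\<Sum>\<gamma>\<in>T. g \<gamma>)"
    using f aug by (subst cls_eq_iff[symmetric]) (auto intro: augmentation_carrier)
  then have "hpart (gen_deg \<Lambda>) \<gamma> f \<doteq> hpart (gen_deg \<Lambda>) \<gamma> (\<Sum>\<gamma>\<in>T. g \<gamma>)"
    by (rule eqv_hpart)
  \<comment> \<open>Each \<open>g \<delta>\<close> is homogeneous of degree \<open>\<delta>\<close>,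
    so only the summand with \<open>\<delta> = \<gamma>\<close> survives.\<close>
  also have "hpart (gen_deg \<Lambda>) \<gamma> (\<Sum>\<gamma>\<in>T. g \<gamma>) = (\<Sum>\<delta>\<in>T. if \<gamma> = \<delta> then g \<delta> else 0)"
    by (simp only: hpart_sum hpart_homogeneous[OF comp_words_homogeneous[OF g(2)]])
  also have "\<dots> = (if \<gamma> \<in> T then g \<gamma> else 0)"
    using fin by (simp add: T_def)
  finally have "cls (hpart (gen_deg \<Lambda>) \<gamma> f) = cls (if \<gamma> \<in> T then g \<gamma> else 0)"
    using cls_eq_iff eqvD by blast
  \<comment> \<open>Outside \<open>T\<close> both sides are \<open>cls 0\<close>.\<close>
  also have "\<dots> = F \<gamma>"
    using g(1)[of \<gamma>] by (auto simp: T_def)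
  finally show ?thesis by simp
qed

lemma direct_sum:
  assumes a: "a \<in> carrier nonunital_quotient"
  shows "\<exists>!F. (\<forall>\<gamma>. F \<gamma> \<in> kp_component \<Lambda> \<gamma>) \<and> finite {\<gamma>. F \<gamma> \<noteq> \<zero>\<^bsub>nonunital_quotient\<^esub>} \<and>
    a = (\<Oplus>\<^bsub>nonunital_quotient\<^esub>\<gamma>\<in>{\<gamma>. F \<gamma> \<noteq> \<zero>\<^bsub>nonunital_quotient\<^esub>}. F \<gamma>)"
proof -
  interpret nonunital_ring nonunital_quotient by (rule nonunital_ring_quotient)
  obtain f where f: "f \<in> augmentation (kp_gens \<Lambda>)" and a_eq: "a = cls f"
    using a by (auto simp: nonunital_quotient_simps)
  define F where "F \<gamma> = cls (hpart (gen_deg \<Lambda>) \<gamma> f)" for \<gamma>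
  let ?D = "wdeg (gen_deg \<Lambda>) ` Poly_Mapping.keys f"
  \<comment> \<open>A nonzero homogeneous part may lie in the ideal, so this inclusion can be
    strict; the additional degrees contribute only zero terms to the sum.\<close>
  have D: "{\<gamma>. F \<gamma> \<noteq> cls 0} \<subseteq> ?D"
  proof
    fix \<gamma> assume "\<gamma> \<in> {\<gamma>. F \<gamma> \<noteq> cls 0}"
    then have "hpart (gen_deg \<Lambda>) \<gamma> f \<noteq> 0" by (auto simp: F_def)
    then have "Poly_Mapping.keys (hpart (gen_deg \<Lambda>) \<gamma> f) \<noteq> {}" by simp
    then show "\<gamma> \<in> ?D" by (auto simp: keys_hpart)
  qed
  have comp: "F \<gamma> \<in> kp_component \<Lambda> \<gamma>" for \<gamma>
    using spans_hpart[OF f, of \<gamma>]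
      augmentation_carrier[OF augmentation_hpart[OF f], of "gen_deg \<Lambda>" \<gamma>]
    by (simp add: F_def spans_comp_words_iff)
  have carr: "F \<gamma> \<in> carrier nonunital_quotient" for \<gamma>
    using augmentation_hpart[OF f, of "gen_deg \<Lambda>" \<gamma>] by (simp add: F_def nonunital_quotient_simps)
  have "a = cls (\<Sum>\<gamma>\<in>?D. hpart (gen_deg \<Lambda>) \<gamma> f)"
    by (simp only: sum_hpart a_eq)
  also have "\<dots> = (\<Oplus>\<^bsub>nonunital_quotient\<^esub>\<gamma>\<in>?D. F \<gamma>)"
    unfolding F_def by (rule finsum_cls[symmetric]) (rule augmentation_hpart[OF f])
  also have "\<dots> = (\<Oplus>\<^bsub>nonunital_quotient\<^esub>\<gamma>\<in>{\<gamma>. F \<gamma> \<noteq> cls 0}. F \<gamma>)"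
    using D carr by (intro add.finprod_mono_neutral_cong_right) (auto simp: nonunital_quotient_simps)
  finally have "a = \<dots>" .
  moreover have "finite {\<gamma>. F \<gamma> \<noteq> cls 0}"
    using D by (rule finite_subset) simp
  moreover have "F' = F"
    if "\<And>\<gamma>. F' \<gamma> \<in> kp_component \<Lambda> \<gamma>" "finite {\<gamma>. F' \<gamma> \<noteq> cls 0}"
      "a = (\<Oplus>\<^bsub>nonunital_quotient\<^esub>\<gamma>\<in>{\<gamma>. F' \<gamma> \<noteq> cls 0}. F' \<gamma>)" for F'
  proof
    fix \<gamma>
    show "F' \<gamma> = F \<gamma>"
      unfolding F_def by (rule direct_sum_unique[OF f that[unfolded a_eq]])
  qed
  ultimately show ?thesis
    using comp unfolding nonunital_quotient_simps by (intro ex1I[of _ F]) simp_all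
qed

section \<open>Regularity\<close>

text \<open>McCoy's lemma with an explicit quasi-inverse. The middle factor is
  \<open>x + (1 - x * g) * y * (1 - g * x)\<close> multiplied out; in this form it visibly lies in
  the augmentation ideal when \<open>g\<close>, \<open>x\<close> and \<open>y\<close> do.\<close>

lemma regular_reduce:
  assumes "g - g * x * g \<doteq> h" "h * y * h \<doteq> h"
    and "g \<in> fcarrier (kp_gens \<Lambda>)" "x \<in> fcarrier (kp_gens \<Lambda>)" "y \<in> fcarrier (kp_gens \<Lambda>)"
  shows "g * (x + y - y * g * x - x * g * y + x * g * y * g * x) * g \<doteq> g"
proof -
  define k where "k = g - g * x * g"
  \<comment> \<open>The four terms containing \<open>y\<close> combine to \<open>k * y * k\<close>,
    since \<open>k\<close> is both \<open>g * (1 - x * g)\<close> and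
    \<open>(1 - g * x) * g\<close>.\<close>
  have "g * (x + y - y * g * x - x * g * y + x * g * y * g * x) * g = g * x * g + k * y * k"
    by (simp add: k_def algebra_simps)
  also have "k * y * k \<doteq> h * y * h"
    using assms(1,5) by (auto simp: k_def intro!: eqv_mult eqv_refl)
  then have "k * y * k \<doteq> k"
    using assms(1,2) eqv_trans eqv_sym unfolding k_def by blast
  then have "g * x * g + k * y * k \<doteq> g * x * g + k"
    using assms(3,4) by (intro eqv_add eqv_refl) auto
  also have "g * x * g + k = g" by (simp add: k_def)
  finally show ?thesis .
qed

definition unit_sum :: "'p set \<Rightarrow> 'p set \<Rightarrow> ('p \<Rightarrow> 'p \<Rightarrow> 'a) \<Rightarrow> 'p kp_gen fword \<Rightarrow>\<^sub>0 'a" where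
  "unit_sum L M A = (\<Sum>l\<in>L. \<Sum>m\<in>M. Poly_Mapping.single (FWord [Path l, Ghost m]) (A l m))"

lemma augmentation_unit_single:
  "l \<in> paths \<Lambda> \<Longrightarrow> m \<in> paths \<Lambda> \<Longrightarrow>
    Poly_Mapping.single (FWord [Path l, Ghost m]) c \<in> augmentation (kp_gens \<Lambda>)"
  unfolding augmentation_iff fcarrier_iff
  by (auto simp: kp_gens_def zero_fword_def split: if_splits)

lemma augmentation_unit_sum:
  "L \<subseteq> paths \<Lambda> \<Longrightarrow> M \<subseteq> paths \<Lambda> \<Longrightarrow> unit_sum L M A \<in> augmentation (kp_gens \<Lambda>)"
  unfolding unit_sum_def by (intro augmentation_sum augmentation_unit_single) auto

text \<open>Sources have to agree only for nonzero coefficients, so that the rule can be applied to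
  all positions of a matrix at once.\<close>

lemma unit_single_mult_eqv:
  assumes "l \<in> paths \<Lambda>" "m \<in> paths \<Lambda>" "a \<in> paths \<Lambda>" "b \<in> paths \<Lambda>"
    and "c \<noteq> 0 \<Longrightarrow> src \<Lambda> l = src \<Lambda> m" "e \<noteq> 0 \<Longrightarrow> src \<Lambda> a = src \<Lambda> b" "deg \<Lambda> m = deg \<Lambda> a"
  shows "Poly_Mapping.single (FWord [Path l, Ghost m]) c * Poly_Mapping.single (FWord [Path a, Ghost b]) e
    \<doteq> (if m = a then Poly_Mapping.single (FWord [Path l, Ghost b]) (c * e) else 0)"
proof (cases "c = 0 \<or> e = 0")
  case True
  then show ?thesis by (auto simp: eqv_refl)
next
  case False
  have scale: "Poly_Mapping.single (FWord [Path l, Ghost m]) k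
      = Poly_Mapping.single 0 k * (pth l * gst m)" for l m and k :: 'a
    by (simp add: single_unit_word[symmetric] mult_single)
  have "Poly_Mapping.single (FWord [Path l, Ghost m]) c * Poly_Mapping.single (FWord [Path a, Ghost b]) e
      = Poly_Mapping.single 0 (c * e) * ((pth l * gst m) * (pth a * gst b))"
    by (simp add: single_unit_word[symmetric] mult_single)
  also have "\<dots> \<doteq> Poly_Mapping.single 0 (c * e) * (if m = a then pth l * gst b else 0)"
    using assms False
    by (intro eqv_mult[OF eqv_refl unit_mult_eqv] fcarrier_single) (auto simp: zero_fword_def)
  also have "\<dots> = (if m = a then Poly_Mapping.single (FWord [Path l, Ghost b]) (c * e) else 0)"
    by (simp add: scale)
  finally show ?thesis .
qed

text \<open>
  Rank-one reduction: subtracting \<open>g x g\<close>, where \<open>x\<close> inverts the entry at \<open>(l0, m0)\<close>, clears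
  the row of \<open>l0\<close>.
\<close>

lemma unit_sum_reduce:
  assumes L: "finite L" "L \<subseteq> paths \<Lambda>" and M: "finite M" "M \<subseteq> paths \<Lambda>"
    and degL: "\<And>l. l \<in> L \<Longrightarrow> deg \<Lambda> l = p" and degM: "\<And>m. m \<in> M \<Longrightarrow> deg \<Lambda> m = q"
    and A: "\<And>l m. l \<in> L \<Longrightarrow> m \<in> M \<Longrightarrow> A l m \<noteq> 0 \<Longrightarrow> src \<Lambda> l = src \<Lambda> m"
    and l0: "l0 \<in> L" and m0: "m0 \<in> M" and nz: "A l0 m0 \<noteq> 0"
  shows "unit_sum L M A
      - unit_sum L M A * Poly_Mapping.single (FWord [Path m0, Ghost l0]) (inverse (A l0 m0)) * unit_sum L M A
    \<doteq> unit_sum L M (\<lambda>l m. A l m - A l m0 * A l0 m / A l0 m0)"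
proof -
  let ?x = "Poly_Mapping.single (FWord [Path m0, Ghost l0]) (inverse (A l0 m0))"
  let ?s = "\<lambda>l m c. Poly_Mapping.single (FWord [Path l, Ghost m]) c"
  have G: "unit_sum L M A \<in> fcarrier (kp_gens \<Lambda>)"
    using augmentation_unit_sum L M augmentation_carrier by blast
  \<comment> \<open>The nonzero pivot forces equal sources, so \<open>?x\<close> is a multiple of a
    matrix unit of the transposed shape.\<close>
  have src0: "src \<Lambda> m0 = src \<Lambda> l0"
    using A[OF l0 m0 nz] by simp
  have "unit_sum L M A * ?x = (\<Sum>l\<in>L. \<Sum>m\<in>M. ?s l m (A l m) * ?x)"
    by (simp add: unit_sum_def sum_distrib_right)
  \<comment> \<open>Only column \<open>m0\<close> survives, scaled by the inverse pivot and moved to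
    the ghost index \<open>l0\<close>.\<close>
  also have "\<dots> \<doteq> (\<Sum>l\<in>L. \<Sum>m\<in>M. if m = m0 then ?s l l0 (A l m * inverse (A l0 m0)) else 0)"
    using L M l0 m0 A degM src0 by (intro eqv_sum unit_single_mult_eqv) auto
  also have "\<dots> = (\<Sum>l\<in>L. ?s l l0 (A l m0 / A l0 m0))"
    using M m0 by (simp add: divide_inverse)
  finally have Gx: "unit_sum L M A * ?x \<doteq> (\<Sum>l\<in>L. ?s l l0 (A l m0 / A l0 m0))" .
  have "unit_sum L M A * ?x * unit_sum L M A
      \<doteq> (\<Sum>l\<in>L. ?s l l0 (A l m0 / A l0 m0)) * unit_sum L M A"
    by (rule eqv_mult[OF Gx eqv_refl[OF G]])
  also have "\<dots> = (\<Sum>l\<in>L. \<Sum>l'\<in>L. \<Sum>m\<in>M. ?s l l0 (A l m0 / A l0 m0) * ?s l' m (A l' m))"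
    by (simp only: unit_sum_def sum_product) (simp only: sum_distrib_left)
  \<comment> \<open>Only row \<open>l0\<close> of the second factor survives; the result is the
    rank-one matrix built from column \<open>m0\<close> and row \<open>l0\<close>.\<close>
  also have "\<dots> \<doteq> (\<Sum>l\<in>L. \<Sum>l'\<in>L. \<Sum>m\<in>M.
      if l0 = l' then ?s l m (A l m0 / A l0 m0 * A l' m) else 0)"
    using L M l0 m0 A degL src0 by (intro eqv_sum unit_single_mult_eqv) auto
  also have "\<dots> = (\<Sum>l\<in>L. \<Sum>l'\<in>L. if l0 = l' then \<Sum>m\<in>M. ?s l m (A l m0 / A l0 m0 * A l' m) else 0)"
    by (intro sum.cong refl) auto
  also have "\<dots> = (\<Sum>l\<in>L. \<Sum>m\<in>M. ?s l m (A l m0 * A l0 m / A l0 m0))"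
    using L l0 by simp
  finally have "unit_sum L M A - unit_sum L M A * ?x * unit_sum L M A
      \<doteq> unit_sum L M A - (\<Sum>l\<in>L. \<Sum>m\<in>M. ?s l m (A l m0 * A l0 m / A l0 m0))"
    by (rule eqv_diff[OF eqv_refl[OF G]])
  then show ?thesis
    by (simp add: unit_sum_def sum_subtractf single_diff)
qed

text \<open>Gaussian elimination as an induction on the rows, with the matrix left arbitrary. A zero
  row is dropped; otherwise a pivot clears the row, and \<open>regular_reduce\<close> carries
  regularity back from the smaller matrix.\<close>

lemma unit_sum_regular:
  assumes "finite L" "L \<subseteq> paths \<Lambda>" and "finite M" "M \<subseteq> paths \<Lambda>"
    and "\<And>l. l \<in> L \<Longrightarrow> deg \<Lambda> l = p" and "\<And>m. m \<in> M \<Longrightarrow> deg \<Lambda> m = q"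
    and "\<And>l m. l \<in> L \<Longrightarrow> m \<in> M \<Longrightarrow> A l m \<noteq> 0 \<Longrightarrow> src \<Lambda> l = src \<Lambda> m"
  shows "\<exists>b \<in> augmentation (kp_gens \<Lambda>). unit_sum L M A * b * unit_sum L M A \<doteq> unit_sum L M A"
  using assms
proof (induction L arbitrary: A rule: finite_induct)
  case empty
  show ?case
    by (rule bexI[OF _ augmentation_zero]) (simp add: unit_sum_def eqv_refl)
next
  case (insert l0 L)
  have drop: "unit_sum (insert l0 L) M B = unit_sum L M B" if "\<And>m. m \<in> M \<Longrightarrow> B l0 m = 0" for B
    using insert.hyps that by (simp add: unit_sum_def)
  have IH: "\<exists>b \<in> augmentation (kp_gens \<Lambda>). unit_sum L M B * b * unit_sum L M B \<doteq> unit_sum L M B"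
    if "\<And>l m. l \<in> L \<Longrightarrow> m \<in> M \<Longrightarrow> B l m \<noteq> 0 \<Longrightarrow> src \<Lambda> l = src \<Lambda> m" for B
    using insert.prems that by (intro insert.IH) auto
  show ?case
  proof (cases "\<forall>m\<in>M. A l0 m = 0")
    case True
    then show ?thesis
      using IH[of A] insert.prems(6) by (simp add: drop)
  next
    case False
    then obtain m0 where m0: "m0 \<in> M" and nz: "A l0 m0 \<noteq> 0" by blast
    define B where "B l m = A l m - A l m0 * A l0 m / A l0 m0" for l m
    define x where "x = Poly_Mapping.single (FWord [Path m0, Ghost l0]) (inverse (A l0 m0))"
    let ?G = "unit_sum (insert l0 L) M A"
    \<comment> \<open>The reduced matrix again vanishes where sources differ: a new nonzero entry
      needs \<open>A l m0\<close> and \<open>A l0 m\<close> nonzero, and with the pivot these link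
      the sources of \<open>l\<close>, \<open>m0\<close>, \<open>l0\<close> and
      \<open>m\<close>.\<close>
    have "src \<Lambda> l = src \<Lambda> m" if lm: "l \<in> L" "m \<in> M" and B: "B l m \<noteq> 0" for l m
    proof (rule ccontr)
      assume neq: "src \<Lambda> l \<noteq> src \<Lambda> m"
      then have "A l m = 0" using insert.prems(6) lm by blast
      with B have "A l m0 \<noteq> 0" "A l0 m \<noteq> 0" by (auto simp: B_def)
      then have "src \<Lambda> l = src \<Lambda> m0" "src \<Lambda> l0 = src \<Lambda> m" "src \<Lambda> l0 = src \<Lambda> m0"
        using lm m0 nz by (intro insert.prems(6); simp)+
      with neq show False by simp
    qed
    then obtain y where y: "y \<in> augmentation (kp_gens \<Lambda>)"
        "unit_sum L M B * y * unit_sum L M B \<doteq> unit_sum L M B"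
      using IH by blast
    \<comment> \<open>Row \<open>l0\<close> of \<open>B\<close> is zero by the choice of pivot, so
      \<open>drop\<close> removes it.\<close>
    have red: "?G - ?G * x * ?G \<doteq> unit_sum L M B"
      using unit_sum_reduce[of "insert l0 L" M p q A l0 m0] insert.hyps insert.prems m0 nz
      by (simp add: x_def drop B_def[abs_def])
    have G: "?G \<in> augmentation (kp_gens \<Lambda>)"
      using insert.prems by (intro augmentation_unit_sum)
    have x: "x \<in> augmentation (kp_gens \<Lambda>)"
      using insert.prems m0 unfolding x_def by (intro augmentation_unit_single) auto
    let ?z = "x + y - y * ?G * x - x * ?G * y + x * ?G * y * ?G * x"
    have "?z \<in> augmentation (kp_gens \<Lambda>)"
      by (intro augmentation_add augmentation_diff augmentation_mult G x y(1))
    moreover have "?G * ?z * ?G \<doteq> ?G"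
      by (intro regular_reduce[OF red y(2)] augmentation_carrier G x y(1))
    ultimately show ?thesis by blast
  qed
qed

text \<open>Each word is expanded until its ghost path has the common degree \<open>q\<close>. The
  path degree then follows from \<open>q\<close> and \<open>\<gamma>\<close>, so it may stay
  existential.\<close>

lemma spans_common_degree:
  assumes f: "Poly_Mapping.keys f \<subseteq> comp_words \<gamma>"
  shows "\<exists>q. spans {w \<in> comp_words \<gamma>. \<exists>p. w \<in> unit_words p q} f"
proof -
  define dg where "dg w = (case w of FWord [Path l, Ghost m] \<Rightarrow> deg \<Lambda> m | _ \<Rightarrow> 0)" for w
  \<comment> \<open>The sum of all ghost degrees dominates each of them, and the amount missing for
    one word is the sum over the others.\<close>
  define q where "q = (\<Sum>w\<in>Poly_Mapping.keys f. dg w)"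
  have "spans {w \<in> comp_words \<gamma>. \<exists>p. w \<in> unit_words p q} (Poly_Mapping.single w 1)"
    if w: "w \<in> Poly_Mapping.keys f" for w
  proof -
    obtain l m where lm: "w = FWord [Path l, Ghost m]" "l \<in> paths \<Lambda>" "m \<in> paths \<Lambda>"
        "src \<Lambda> l = src \<Lambda> m" "int_deg \<Lambda> l - int_deg \<Lambda> m = \<gamma>"
      using w f by (auto simp: comp_words_def)
    define n where "n = (\<Sum>u\<in>Poly_Mapping.keys f - {w}. dg u)"
    have "q = deg \<Lambda> m + n"
      using w by (simp add: q_def n_def sum.remove[of _ w] dg_def lm(1))
    moreover have "unit_words (deg \<Lambda> l + n) (deg \<Lambda> m + n) \<subseteq> comp_words \<gamma>"
      using lm(5) by (auto simp: unit_words_def comp_words_def int_deg_def vec_eq_iff)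
    ultimately show ?thesis
      using spans_expand[OF lm(2-4), of n]
      unfolding lm(1) single_unit_word spans_def by blast
  qed
  moreover have "spans (Poly_Mapping.keys f) f"
    using f by (intro spansI[OF eqv_refl] augmentation_carrier comp_words_augmentation) auto
  ultimately show ?thesis
    using spans_trans by blast
qed

text \<open>Rows and columns are the paths occurring in the support, and the matrix entries are the
  coefficients of \<open>f\<close>.\<close>

lemma unit_words_sum:
  assumes "Poly_Mapping.keys f \<subseteq> unit_words p q"
  obtains L M A where "finite L" "L \<subseteq> paths \<Lambda>" "finite M" "M \<subseteq> paths \<Lambda>"
    "\<And>l. l \<in> L \<Longrightarrow> deg \<Lambda> l = p" "\<And>m. m \<in> M \<Longrightarrow> deg \<Lambda> m = q"
    "\<And>l m. A l m \<noteq> 0 \<Longrightarrow> src \<Lambda> l = src \<Lambda> m"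
    "f = unit_sum L M A"
proof -
  define W where "W = (\<lambda>(l, m). FWord [Path l, Ghost m :: 'p kp_gen])"
  define P where "P = {(l, m). W (l, m) \<in> Poly_Mapping.keys f}"
  define A where "A l m = Poly_Mapping.lookup f (W (l, m))" for l m
  have inj: "inj W" by (auto simp: W_def inj_def)
  have P: "Poly_Mapping.keys f = W ` P" "P = W -` Poly_Mapping.keys f"
    using assms by (auto simp: P_def W_def unit_words_def)
  have fin: "finite P"
    unfolding P(2) by (intro finite_vimageI inj) simp
  have *: "l \<in> paths \<Lambda> \<and> m \<in> paths \<Lambda> \<and> src \<Lambda> l = src \<Lambda> m \<and> deg \<Lambda> l = p \<and> deg \<Lambda> m = q"
    if "(l, m) \<in> P" for l m
    using assms that by (auto simp: P_def W_def unit_words_def)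
  show ?thesis
  proof
    show "finite (fst ` P)" "finite (snd ` P)" using fin by auto
    show "fst ` P \<subseteq> paths \<Lambda>" "snd ` P \<subseteq> paths \<Lambda>" using * by auto
    show "deg \<Lambda> l = p" if "l \<in> fst ` P" for l using * that by auto
    show "deg \<Lambda> m = q" if "m \<in> snd ` P" for m using * that by auto
    show "src \<Lambda> l = src \<Lambda> m" if "A l m \<noteq> 0" for l m
      using * that by (auto simp: A_def P_def in_keys_iff)
    have "f = (\<Sum>w\<in>W ` P. Poly_Mapping.single w (Poly_Mapping.lookup f w))"
      using poly_mapping_eq_sum_single[of f] P(1) by simp
    also have "\<dots> = (\<Sum>x\<in>P. Poly_Mapping.single (W x) (Poly_Mapping.lookup f (W x)))"
      by (subst sum.reindex) (use inj in \<open>auto intro: inj_on_subset\<close>)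
    \<comment> \<open>Pairs of the rectangle outside \<open>P\<close> have coefficient zero, so the
      sum extends to the full matrix.\<close>
    also have "\<dots> = (\<Sum>x\<in>fst ` P \<times> snd ` P. Poly_Mapping.single (W x) (Poly_Mapping.lookup f (W x)))"
      by (rule sum.mono_neutral_left)
        (use fin in \<open>force simp: P_def not_in_keys_iff_lookup_eq_zero\<close>)+
    also have "\<dots> = unit_sum (fst ` P) (snd ` P) A"
      by (simp add: unit_sum_def A_def sum.cartesian_product W_def case_prod_unfold)
    finally show "f = unit_sum (fst ` P) (snd ` P) A" .
  qed
qed

lemma component_regular:
  assumes "a \<in> kp_component \<Lambda> \<gamma>"
  shows "\<exists>b \<in> carrier nonunital_quotient.
    a \<otimes>\<^bsub>nonunital_quotient\<^esub> b \<otimes>\<^bsub>nonunital_quotient\<^esub> a = a"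
proof -
  obtain f where f: "a = cls f" "Poly_Mapping.keys f \<subseteq> comp_words \<gamma>"
    using assms by (auto simp: kp_component_eq)
  obtain q g where g: "Poly_Mapping.keys g \<subseteq> {w \<in> comp_words \<gamma>. \<exists>p. w \<in> unit_words p q}" "f \<doteq> g"
    using spans_common_degree[OF f(2)] unfolding spans_def by blast
  \<comment> \<open>If \<open>g\<close> is zero, any \<open>p\<close> serves. Otherwise
    \<open>p\<close> is read off from one word: over the integers it is \<open>\<gamma>\<close> plus
    \<open>q\<close>, hence the same for all words.\<close>
  have "\<exists>p. Poly_Mapping.keys g \<subseteq> unit_words p q"
  proof (cases "Poly_Mapping.keys g = {}")
    case False
    then obtain u p where u: "u \<in> comp_words \<gamma>" "u \<in> unit_words p q" using g(1) by blast
    have "p' = p" if w: "w \<in> comp_words \<gamma>" "w \<in> unit_words p' q" for w p'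
    proof -
      have int_p: "(\<chi> i. int (r $ i)) - (\<chi> i. int (q $ i)) = \<gamma>"
        if "w \<in> comp_words \<gamma>" "w \<in> unit_words r q" for w r
        using that by (auto simp: comp_words_def unit_words_def int_deg_def)
      have "(\<chi> i. int (p' $ i)) = (\<chi> i. int (p $ i))"
        using int_p[OF u] int_p[OF w] by (metis diff_add_cancel)
      then show ?thesis by (simp add: vec_eq_iff)
    qed
    with g(1) show ?thesis by (intro exI[of _ p]) auto
  qed auto
  then obtain p where "Poly_Mapping.keys g \<subseteq> unit_words p q" ..
  then obtain L M A where LMA: "finite L" "L \<subseteq> paths \<Lambda>" "finite M" "M \<subseteq> paths \<Lambda>"
    "\<And>l. l \<in> L \<Longrightarrow> deg \<Lambda> l = p" "\<And>m. m \<in> M \<Longrightarrow> deg \<Lambda> m = q"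
    "\<And>l m. A l m \<noteq> 0 \<Longrightarrow> src \<Lambda> l = src \<Lambda> m" "g = unit_sum L M A"
    by (rule unit_words_sum) blast
  then obtain b where b: "b \<in> augmentation (kp_gens \<Lambda>)" "g * b * g \<doteq> g"
    using unit_sum_regular[of L M p q A] by blast
  have carr: "g \<in> fcarrier (kp_gens \<Lambda>)" "b \<in> fcarrier (kp_gens \<Lambda>)"
    using b(1) g(2) eqvD augmentation_carrier by blast+
  have "a = cls g"
    using cls_eq_iff eqvD g(2) f(1) by blast
  moreover have "cls (g * b * g) = cls g"
    using cls_eq_iff eqvD b(2) by blast
  ultimately show ?thesis
    using b(1) carr by (intro bexI[of _ "cls b"])
      (auto simp: cls_mult fcarrier_mult nonunital_quotient_simps)
qed

lemma graded_von_neumann_regular_kumjian_pask: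
  "graded_von_neumann_regular (kumjian_pask \<Lambda> :: ('p kp_gen fword \<Rightarrow>\<^sub>0 'a) set ring) (kp_component \<Lambda>)"
  unfolding kumjian_pask_eq
  by (intro graded_von_neumann_regular.intro graded_ring.intro graded_ring_axioms.intro
      graded_von_neumann_regular_axioms.intro nonunital_ring_quotient component_subgroup
      component_mult direct_sum component_regular)

end

theorem theorem6p4:
  fixes \<Lambda> :: "('p, 'k::finite) kgraph"
  assumes "k_graph \<Lambda>"
    and "row_finite \<Lambda>"
    and "no_sources \<Lambda>"
  shows "graded_von_neumann_regular
    (kumjian_pask \<Lambda> :: ('p kp_gen fword \<Rightarrow>\<^sub>0 'a::field) set ring)
    (kp_component \<Lambda> :: int^'k \<Rightarrow> ('p kp_gen fword \<Rightarrow>\<^sub>0 'a) set set)"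
proof -
  interpret k_graph \<Lambda> by fact
  \<comment> \<open>The relators lie in the carrier, so the ideal they generate is an ideal of the
    free algebra.\<close>
  interpret kp_algebra \<Lambda> "kp_ideal \<Lambda> :: ('p kp_gen fword \<Rightarrow>\<^sub>0 'a) set"
    by (intro kp_algebra.intro kp_algebra_axioms.intro free_algebra_ideal.intro assms refl)
      (simp add: kp_ideal_def ring.genideal_ideal[OF ring_free_algebra kp_relators_carrier])
  show ?thesis
    by (rule graded_von_neumann_regular_kumjian_pask)
qed

end
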